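(* Let $\mu\in\mathcal{M}$. (i) The quadratic form $Q_\mu[f]=\int_0^\infty |\mathcal{L}f(x)|^2\,d\mu(x)$, defined on the domain $$\operatorname{Dom} Q_\mu=\Big\{f\in L^2(\mathbb{R}_+): \int_0^\infty |\mathcal{L} f(x)|^2\,d\mu(x)<\infty\Big\},$$ is closed. (ii) The set $C^\infty_{\mathrm{comp}}(\mathbb{R}_+)$ is dense in $\operatorname{Dom} Q_\mu$ with respect to the norm induced by $Q_\mu$, i.e. the norm $f\mapsto (\|f\|_{L^2}^2+Q_\mu[f])^{1/2}$.
   Context: $\mathbb{R}_+=(0,\infty)$. $\mathcal{M}$ is the class of positive Borel measures $\mu$ on $\mathbb{R}$ with $\operatorname{supp}\mu\subset[0,\infty)$, $\mu(\{0\})=0$ and $\int_0^\infty e^{-tx}\,d\mu(x)<\infty$ for all $t>0$. For $f\in L^2(\mathbb{R}_+)$, $\mathcal{L}f(x)=\int_0^\infty e^{-tx}f(t)\,dt$, $x>0$, is the Laplace transform. $C^\infty_{\mathrm{comp}}(\mathbb{R}_+)$ is the set of infinitely smooth complex-valued functions with compact support in $(0,\infty)$ (so the support is separated away from the origin). *)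

theory Defs
  imports "HOL-Analysis.Analysis"
begin

text \<open>
  Elements of $L^2(0,\infty)$ are represented by square-integrable functions; the values
  of a representative outside \<open>{0<..}\<close> are never used. Functions that agree almost everywhere
  on \<open>{0<..}\<close> are not identified, so \<open>L2_norm\<close> is only a seminorm on \<open>L2_pos\<close>; instead
  \<open>quadratic_form\<close> demands invariance under almost-everywhere equality.
\<close>

definition L2_pos :: "(real \<Rightarrow> complex) set" where
  "L2_pos = {f. f \<in> borel_measurable (lebesgue_on {0<..}) \<and>
                integrable (lebesgue_on {0<..}) (\<lambda>t. (cmod (f t))\<^sup>2)}"

definition L2_norm :: "(real \<Rightarrow> complex) \<Rightarrow> real" where
  "L2_norm f = sqrt (LINT t|lebesgue_on {0<..}. (cmod (f t))\<^sup>2)"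

definition measure_support :: "real measure \<Rightarrow> real set" where
  "measure_support \<mu> = {x. \<forall>U. open U \<and> x \<in> U \<longrightarrow> emeasure \<mu> U > 0}"

definition class_M :: "real measure set" where
  "class_M = {\<mu>. sets \<mu> = sets borel \<and> measure_support \<mu> \<subseteq> {0..} \<and> emeasure \<mu> {0} = 0 \<and>
                 (\<forall>t>0. set_integrable \<mu> {0<..} (\<lambda>x. exp (- t * x)))}"

definition laplace :: "(real \<Rightarrow> complex) \<Rightarrow> real \<Rightarrow> complex" where
  "laplace f x = (LINT t|lebesgue_on {0<..}. complex_of_real (exp (- t * x)) * f t)"

text \<open>As elements of \<open>class_M\<close> give \<open>{0}\<close> measure zero, $\int_0^\infty$ is taken over \<open>{0<..}\<close>,
  where the Laplace transform is defined.\<close>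

definition Q_form :: "real measure \<Rightarrow> (real \<Rightarrow> complex) \<Rightarrow> real" where
  "Q_form \<mu> f = (LINT x:{0<..}|\<mu>. (cmod (laplace f x))\<^sup>2)"

definition Dom_Q :: "real measure \<Rightarrow> (real \<Rightarrow> complex) set" where
  "Dom_Q \<mu> = {f \<in> L2_pos. set_integrable \<mu> {0<..} (\<lambda>x. (cmod (laplace f x))\<^sup>2)}"

definition quadratic_form ::
    "(real \<Rightarrow> complex) set \<Rightarrow> ((real \<Rightarrow> complex) \<Rightarrow> real) \<Rightarrow> bool" where
  "quadratic_form D Q \<longleftrightarrow>
     D \<subseteq> L2_pos \<and>
     (\<lambda>t. 0) \<in> D \<and>
     (\<forall>f\<in>D. \<forall>g\<in>D. (\<lambda>t. f t + g t) \<in> D) \<and>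
     (\<forall>c. \<forall>f\<in>D. (\<lambda>t. c * f t) \<in> D) \<and>
     (\<forall>f\<in>D. \<forall>g. (AE t in lebesgue_on {0<..}. f t = g t) \<longrightarrow> g \<in> D \<and> Q g = Q f) \<and>
     (\<exists>B :: (real \<Rightarrow> complex) \<Rightarrow> (real \<Rightarrow> complex) \<Rightarrow> complex.
        (\<forall>f\<in>D. \<forall>g\<in>D. \<forall>h\<in>D.
           B (\<lambda>t. f t + g t) h = B f h + B g h \<and>
           B h (\<lambda>t. f t + g t) = B h f + B h g) \<and>
        (\<forall>c. \<forall>f\<in>D. \<forall>g\<in>D.
           B (\<lambda>t. c * f t) g = c * B f g \<and>
           B f (\<lambda>t. c * g t) = cnj c * B f g) \<and>
        (\<forall>f\<in>D. complex_of_real (Q f) = B f f))"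

definition form_norm :: "((real \<Rightarrow> complex) \<Rightarrow> real) \<Rightarrow> (real \<Rightarrow> complex) \<Rightarrow> real" where
  "form_norm Q f = sqrt ((L2_norm f)\<^sup>2 + Q f)"

text \<open>A nonnegative quadratic form is closed if its domain is complete in the form norm.\<close>

definition closed_form ::
    "(real \<Rightarrow> complex) set \<Rightarrow> ((real \<Rightarrow> complex) \<Rightarrow> real) \<Rightarrow> bool" where
  "closed_form D Q \<longleftrightarrow>
     quadratic_form D Q \<and> (\<forall>f\<in>D. 0 \<le> Q f) \<and>
     (\<forall>f :: nat \<Rightarrow> real \<Rightarrow> complex.
        (\<forall>n. f n \<in> D) \<and>
        (\<forall>e>0. \<exists>N. \<forall>m\<ge>N. \<forall>n\<ge>N. form_norm Q (\<lambda>t. f m t - f n t) < e)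
        \<longrightarrow> (\<exists>g\<in>D. (\<lambda>n. form_norm Q (\<lambda>t. f n t - g t)) \<longlonglongrightarrow> 0))"

text \<open>\<open>F n\<close> is the \<open>n\<close>-th derivative of \<open>f\<close>. The closure is taken in the whole real line, so
  its being a compact subset of \<open>{0<..}\<close> keeps the support away from the origin.\<close>

definition Cinf_comp :: "(real \<Rightarrow> complex) set" where
  "Cinf_comp =
     {f. (\<exists>F :: nat \<Rightarrow> real \<Rightarrow> complex. F 0 = f \<and>
            (\<forall>n. \<forall>t>0. (F n has_vector_derivative F (Suc n) t) (at t))) \<and>
         compact (closure {t \<in> {0<..}. f t \<noteq> 0}) \<and>
         closure {t \<in> {0<..}. f t \<noteq> 0} \<subseteq> {0<..}}"

definition dense_wrt ::
    "((real \<Rightarrow> complex) \<Rightarrow> real) \<Rightarrow> (real \<Rightarrow> complex) set \<Rightarrow> (real \<Rightarrow> complex) set \<Rightarrow> bool" where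
  "dense_wrt N C D \<longleftrightarrow> C \<subseteq> D \<and> (\<forall>f\<in>D. \<forall>e>0. \<exists>h\<in>C. N (\<lambda>t. f t - h t) < e)"

end

theory Submission
  imports Defs
begin

text \<open>
  Write \<open>\<L>f\<close> for the Laplace transform. By the Cauchy-Schwarz inequality,
  \<open>\<bar>\<L>f x\<bar>\<^sup>2 \<le> \<parallel>f\<parallel>\<^sup>2 / (2 * x)\<close> for \<open>x > 0\<close> (\<open>laplace_bound\<close>), so $L^2$ convergence implies pointwise
  convergence of the transforms. This gives closedness at once: a Cauchy sequence \<open>f n\<close> in the form norm
  has an $L^2$ limit \<open>g\<close> (\<open>Riesz_Fischer\<close>), and Fatou's lemma bounds the form at \<open>f n - g\<close> by its values at
  \<open>f n - f m\<close> (\<open>Dom_Q_complete\<close>).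

  It also gives the criterion used for density (\<open>energy_tendsto_dominated\<close>): an $L^2$ convergent
  sequence converges in the form norm as soon as the transforms have a common majorant in \<open>L\<^sup>2(\<mu>)\<close>.
  Two majorants are available: \<open>\<bar>\<L>f\<bar>\<close> itself for \<open>f\<close> in the domain, and \<open>C * exp (- b * x)\<close> with \<open>b > 0\<close>,
  by the definition of the class of measures. Cutting off \<open>f\<close> near \<open>t = 0\<close> or at large \<open>t\<close>
  respects neither: whether \<open>\<L>f\<close> is square integrable may depend on cancellations, near
  infinity and near zero, that a cut-off destroys. The cut-offs are therefore replaced by convolutions,
  which multiply \<open>\<L>f\<close> by a function with values in \<open>{0..1}\<close> and so keep \<open>\<bar>\<L>f\<bar>\<close> as majorant.

  \<^item> A delay by \<open>a\<close> gives the multiplier \<open>exp (- a * x)\<close>, hence decay at infinity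
    (\<open>approximable_causal\<close>). Small delays are close to the identity in $L^2$.

  \<^item> Subtracting the mean of \<open>N\<close> copies delayed by \<open>T, 2 T, \<dots>, N T\<close> gives a multiplier that is
    at most \<open>N T x\<close>, which removes the singularity of \<open>\<L>f\<close> at zero (\<open>approximable_delayed\<close>). For
    large \<open>T\<close> the copies are almost orthogonal, so the subtracted mean has norm about
    \<open>\<parallel>f\<parallel> / sqrt N\<close> and disappears in the limit (\<open>shift_average_L2_bound\<close>).

  After both operations \<open>\<bar>\<L>f x\<bar> \<le> C * exp (- b * x)\<close>. Now \<open>f\<close> may be damped by \<open>exp (- \<delta> * t)\<close>, which
  translates \<open>\<L>f\<close> by \<open>\<delta>\<close> and keeps this majorant (\<open>approximable_exp_decay\<close>). The damped function is
  integrable and vanishes near \<open>t = 0\<close>. For such functions dominated convergence in $t$ gives convergence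
  in the form norm (\<open>energy_tendsto_tame\<close>), and the usual path from smooth bumps over intervals,
  Borel sets and simple functions leads to all of them (\<open>approximable_tame\<close>). Applied to the measure zero,
  this last step also yields density of the test functions in $L^2$, from which continuity
  of translations in $L^2$ follows.
\<close>

section \<open>Square-integrable functions on a measure space\<close>

definition square_integrable :: "'a measure \<Rightarrow> ('a \<Rightarrow> complex) \<Rightarrow> bool" where
  "square_integrable M f \<longleftrightarrow> f \<in> borel_measurable M \<and> integrable M (\<lambda>x. (cmod (f x))\<^sup>2)"

lemma cmod_add_sq_le: "(cmod (z + w))\<^sup>2 \<le> 2 * (cmod z)\<^sup>2 + 2 * (cmod w)\<^sup>2"
proof -
  have "(cmod (z + w))\<^sup>2 \<le> (cmod z + cmod w)\<^sup>2"
    by (simp add: norm_triangle_ineq power_mono)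
  also have "\<dots> \<le> 2 * (cmod z)\<^sup>2 + 2 * (cmod w)\<^sup>2"
    using sum_squares_bound[of "cmod z" "cmod w"] by (simp add: power2_sum)
  finally show ?thesis .
qed

lemma cmod_diff_sq_le: "(cmod (z - w))\<^sup>2 \<le> 2 * (cmod z)\<^sup>2 + 2 * (cmod w)\<^sup>2"
  using cmod_add_sq_le[of z "- w"] by simp

lemma square_integrable_bound:
  assumes "f \<in> borel_measurable M" "integrable M h" "AE x in M. (cmod (f x))\<^sup>2 \<le> h x"
  shows "square_integrable M f"
proof -
  have "integrable M (\<lambda>x. (cmod (f x))\<^sup>2)"
    by (rule Bochner_Integration.integrable_bound[OF assms(2)]) (use assms in auto)
  then show ?thesis using assms(1) by (simp add: square_integrable_def)
qed

lemma square_integrable_add: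
  assumes "square_integrable M f" "square_integrable M g"
  shows "square_integrable M (\<lambda>x. f x + g x)"
  by (rule square_integrable_bound[where h = "\<lambda>x. 2 * (cmod (f x))\<^sup>2 + 2 * (cmod (g x))\<^sup>2"])
     (use assms in \<open>auto simp: square_integrable_def cmod_add_sq_le\<close>)

lemma square_integrable_cmult:
  assumes "square_integrable M f"
  shows "square_integrable M (\<lambda>x. c * f x)"
  using assms by (auto simp: square_integrable_def norm_mult power_mult_distrib)

lemma square_integrable_diff:
  assumes "square_integrable M f" "square_integrable M g"
  shows "square_integrable M (\<lambda>x. f x - g x)"
  using square_integrable_add[OF assms(1) square_integrable_cmult[OF assms(2), of "-1"]] by simp

lemma square_integrable_cong_AE:
  assumes "square_integrable M f" "g \<in> borel_measurable M" "AE x in M. f x = g x"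
  shows "square_integrable M g"
  by (rule square_integrable_bound[where h = "\<lambda>x. (cmod (f x))\<^sup>2"])
     (use assms in \<open>auto simp: square_integrable_def\<close>)

lemma integral_sq_add_le:
  assumes "square_integrable M f" "square_integrable M g"
  shows "(\<integral>x. (cmod (f x + g x))\<^sup>2 \<partial>M) \<le> 2 * (\<integral>x. (cmod (f x))\<^sup>2 \<partial>M) + 2 * (\<integral>x. (cmod (g x))\<^sup>2 \<partial>M)"
proof -
  have "(\<integral>x. (cmod (f x + g x))\<^sup>2 \<partial>M) \<le> (\<integral>x. 2 * (cmod (f x))\<^sup>2 + 2 * (cmod (g x))\<^sup>2 \<partial>M)"
    by (rule integral_mono) (use assms square_integrable_add[OF assms] in
        \<open>auto simp: square_integrable_def cmod_add_sq_le\<close>)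
  also have "\<dots> = 2 * (\<integral>x. (cmod (f x))\<^sup>2 \<partial>M) + 2 * (\<integral>x. (cmod (g x))\<^sup>2 \<partial>M)"
    using assms by (simp add: square_integrable_def)
  finally show ?thesis .
qed

lemma square_integrable_mult:
  assumes "square_integrable M f" "square_integrable M g"
  shows "integrable M (\<lambda>x. f x * g x)"
proof (rule Bochner_Integration.integrable_bound)
  show "integrable M (\<lambda>x. (cmod (f x))\<^sup>2 + (cmod (g x))\<^sup>2)"
    using assms by (simp add: square_integrable_def)
  show "(\<lambda>x. f x * g x) \<in> borel_measurable M"
    using assms by (auto simp: square_integrable_def)
  have "cmod (f x * g x) \<le> (cmod (f x))\<^sup>2 + (cmod (g x))\<^sup>2" for x
  proof -
    have "2 * (cmod (f x) * cmod (g x)) \<le> (cmod (f x))\<^sup>2 + (cmod (g x))\<^sup>2"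
      using sum_squares_bound[of "cmod (f x)" "cmod (g x)"] by (simp add: mult.assoc)
    moreover have "0 \<le> cmod (f x) * cmod (g x)" by simp
    ultimately show ?thesis unfolding norm_mult by linarith
  qed
  then show "AE x in M. norm (f x * g x) \<le> norm ((cmod (f x))\<^sup>2 + (cmod (g x))\<^sup>2)"
    by auto
qed

text \<open>
  The quadratic polynomial \<open>c \<mapsto> \<integral>(c \<bar>f\<bar> - \<bar>g\<bar>)\<^sup>2\<close> is nonnegative; evaluating it at its minimum
  gives the inequality.
\<close>

lemma Cauchy_Schwarz_integral:
  assumes f: "square_integrable M f" and g: "square_integrable M g"
  shows "(cmod (\<integral>x. f x * g x \<partial>M))\<^sup>2 \<le> (\<integral>x. (cmod (f x))\<^sup>2 \<partial>M) * (\<integral>x. (cmod (g x))\<^sup>2 \<partial>M)"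
proof -
  define A B P where "A = (\<integral>x. (cmod (f x))\<^sup>2 \<partial>M)" and "B = (\<integral>x. (cmod (g x))\<^sup>2 \<partial>M)"
    and "P = (\<integral>x. cmod (f x * g x) \<partial>M)"
  have int: "integrable M (\<lambda>x. (cmod (f x))\<^sup>2)" "integrable M (\<lambda>x. (cmod (g x))\<^sup>2)"
    "integrable M (\<lambda>x. cmod (f x * g x))"
    using f g square_integrable_mult[OF f g] by (auto simp: square_integrable_def)
  have nonneg: "A \<ge> 0" "B \<ge> 0" "P \<ge> 0" by (auto simp: A_def B_def P_def)
  have quad: "0 \<le> A * c\<^sup>2 - 2 * P * c + B" for c
  proof -
    have "0 \<le> (\<integral>x. (c * cmod (f x) - cmod (g x))\<^sup>2 \<partial>M)" by simp
    also have "(\<lambda>x. (c * cmod (f x) - cmod (g x))\<^sup>2) =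
        (\<lambda>x. c\<^sup>2 * (cmod (f x))\<^sup>2 - 2 * c * cmod (f x * g x) + (cmod (g x))\<^sup>2)"
      by (auto simp: power2_diff power_mult_distrib norm_mult algebra_simps)
    also have "(\<integral>x. c\<^sup>2 * (cmod (f x))\<^sup>2 - 2 * c * cmod (f x * g x) + (cmod (g x))\<^sup>2 \<partial>M) = c\<^sup>2 * A - 2 * c * P + B"
      using int by (simp add: A_def B_def P_def)
    finally show ?thesis by (simp add: algebra_simps)
  qed
  have "P\<^sup>2 \<le> A * B"
  proof (cases "A = 0")
    case True
    have "P = 0"
    proof (rule ccontr)
      assume "P \<noteq> 0"
      then have "0 \<le> - (2 * P * ((B + 1) / (2 * P))) + B"
        using quad[of "(B + 1) / (2 * P)"] True by simp
      also have "\<dots> = - 1" using \<open>P \<noteq> 0\<close> by simp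
      finally show False by simp
    qed
    then show ?thesis using nonneg by simp
  next
    case False
    then have "A > 0" using nonneg by simp
    have "0 \<le> A * (P / A)\<^sup>2 - 2 * P * (P / A) + B" by (rule quad)
    also have "\<dots> = (A * B - P\<^sup>2) / A" using \<open>A > 0\<close> by (simp add: field_simps power2_eq_square)
    finally show ?thesis using \<open>A > 0\<close> by (simp add: zero_le_divide_iff)
  qed
  moreover have "(cmod (\<integral>x. f x * g x \<partial>M))\<^sup>2 \<le> P\<^sup>2"
    unfolding P_def by (intro power_mono integral_norm_bound) auto
  ultimately show ?thesis unfolding A_def B_def by linarith
qed

text \<open>
  Dominated convergence in $L^2$: \<open>\<bar>s n - f\<bar>\<^sup>2 \<le> 4 G\<^sup>2\<close>. All approximations below converge for
  this reason, both in the variable of the function and in the variable of its transform.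
\<close>

lemma square_integrable_dominated:
  assumes f: "f \<in> borel_measurable M" and s: "\<And>n. s n \<in> borel_measurable M"
    and lim: "AE x in M. (\<lambda>n. s n x) \<longlonglongrightarrow> f x"
    and bound: "\<And>n. AE x in M. cmod (s n x) \<le> G x"
    and G: "integrable M (\<lambda>x. (G x)\<^sup>2)"
  shows "square_integrable M f" and "\<And>n. square_integrable M (s n)"
    and "(\<lambda>n. \<integral>x. (cmod (s n x - f x))\<^sup>2 \<partial>M) \<longlonglongrightarrow> 0"
proof -
  have bound_all: "AE x in M. \<forall>n. cmod (s n x) \<le> G x"
    using bound by (simp add: AE_all_countable)
  have bound_f: "AE x in M. cmod (f x) \<le> G x"
    using lim bound_all
  proof eventually_elim
    case (elim x)
    show ?case
      by (rule Lim_bounded[OF tendsto_norm[OF elim(1)], of 0]) (use elim(2) in auto)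
  qed
  show "square_integrable M f"
  proof (rule square_integrable_bound[OF f G])
    show "AE x in M. (cmod (f x))\<^sup>2 \<le> (G x)\<^sup>2"
      using bound_f by eventually_elim (simp add: power_mono)
  qed
  show "square_integrable M (s n)" for n
  proof (rule square_integrable_bound[OF s G])
    show "AE x in M. (cmod (s n x))\<^sup>2 \<le> (G x)\<^sup>2"
      using bound[of n] by eventually_elim (simp add: power_mono)
  qed
  have "(\<lambda>n. \<integral>x. (cmod (s n x - f x))\<^sup>2 \<partial>M) \<longlonglongrightarrow> (\<integral>x. 0 \<partial>M)"
  proof (rule integral_dominated_convergence[where w = "\<lambda>x. 4 * (G x)\<^sup>2"])
    show "AE x in M. (\<lambda>n. (cmod (s n x - f x))\<^sup>2) \<longlonglongrightarrow> 0"
      using lim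
    proof eventually_elim
      case (elim x)
      have "(\<lambda>n. s n x - f x) \<longlonglongrightarrow> 0" using elim by (simp add: LIM_zero_iff)
      then have "(\<lambda>n. (cmod (s n x - f x))\<^sup>2) \<longlonglongrightarrow> 0\<^sup>2"
        by (intro tendsto_power) (simp add: tendsto_norm_zero_iff)
      then show ?case by simp
    qed
    show "AE x in M. norm ((cmod (s n x - f x))\<^sup>2) \<le> 4 * (G x)\<^sup>2" for n
      using bound_all bound_f
    proof eventually_elim
      case (elim x)
      have "(cmod (s n x))\<^sup>2 \<le> (G x)\<^sup>2" "(cmod (f x))\<^sup>2 \<le> (G x)\<^sup>2"
        using elim by (auto intro: power_mono)
      then show ?case using cmod_diff_sq_le[of "s n x" "f x"] by simp
    qed
  qed (use f s G in auto)
  then show "(\<lambda>n. \<integral>x. (cmod (s n x - f x))\<^sup>2 \<partial>M) \<longlonglongrightarrow> 0" by simp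
qed

text \<open>
  Fatou's lemma in the form in which completeness uses it: a bound on $L^2$ norms passes to
  pointwise limits.
\<close>

lemma square_integrable_Fatou:
  assumes f: "f \<in> borel_measurable M" and s: "\<And>n. square_integrable M (s n)"
    and lim: "AE x in M. (\<lambda>n. s n x) \<longlonglongrightarrow> f x"
    and le: "\<And>n. (\<integral>x. (cmod (s n x))\<^sup>2 \<partial>M) \<le> c"
  shows "square_integrable M f \<and> (\<integral>x. (cmod (f x))\<^sup>2 \<partial>M) \<le> c"
proof -
  have m [measurable]: "s n \<in> borel_measurable M" for n using s by (simp add: square_integrable_def)
  note f [measurable]
  have "0 \<le> (\<integral>x. (cmod (s 0 x))\<^sup>2 \<partial>M)" by simp
  with le[of 0] have c: "c \<ge> 0" by linarith
  have "(\<integral>\<^sup>+x. ennreal ((cmod (f x))\<^sup>2) \<partial>M) = (\<integral>\<^sup>+x. liminf (\<lambda>n. ennreal ((cmod (s n x))\<^sup>2)) \<partial>M)"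
  proof (rule nn_integral_cong_AE)
    show "AE x in M. ennreal ((cmod (f x))\<^sup>2) = liminf (\<lambda>n. ennreal ((cmod (s n x))\<^sup>2))"
      using lim
    proof eventually_elim
      case (elim x)
      have "(\<lambda>n. ennreal ((cmod (s n x))\<^sup>2)) \<longlonglongrightarrow> ennreal ((cmod (f x))\<^sup>2)"
        by (intro tendsto_ennrealI tendsto_power tendsto_norm elim)
      then show ?case using lim_imp_Liminf[OF sequentially_bot] by metis
    qed
  qed
  also have "\<dots> \<le> liminf (\<lambda>n. \<integral>\<^sup>+x. ennreal ((cmod (s n x))\<^sup>2) \<partial>M)"
    by (rule nn_integral_liminf) measurable
  also have "\<dots> \<le> liminf (\<lambda>n::nat. ennreal c)"
  proof (rule Liminf_mono, rule always_eventually, rule allI)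
    fix n
    have "(\<integral>\<^sup>+x. ennreal ((cmod (s n x))\<^sup>2) \<partial>M) = ennreal (\<integral>x. (cmod (s n x))\<^sup>2 \<partial>M)"
      using s by (intro nn_integral_eq_integral) (auto simp: square_integrable_def)
    then show "(\<integral>\<^sup>+x. ennreal ((cmod (s n x))\<^sup>2) \<partial>M) \<le> ennreal c"
      using le by (simp add: ennreal_leI)
  qed
  also have "\<dots> = ennreal c" by (simp add: Liminf_const)
  finally have nn: "(\<integral>\<^sup>+x. ennreal ((cmod (f x))\<^sup>2) \<partial>M) \<le> ennreal c" .
  then have int: "integrable M (\<lambda>x. (cmod (f x))\<^sup>2)"
    by (intro integrableI_bounded) (auto simp: le_less_trans)
  have "ennreal (\<integral>x. (cmod (f x))\<^sup>2 \<partial>M) \<le> ennreal c"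
    using nn nn_integral_eq_integral[OF int] by simp
  then show ?thesis using int f c by (simp add: square_integrable_def ennreal_le_iff)
qed

text \<open>
  The weights \<open>2 ^ k\<close> replace Minkowski's inequality: the integral of
  \<open>\<Sum>k. 2 ^ k * \<bar>f (k + 1) - f k\<bar>\<^sup>2\<close> is finite, hence almost everywhere the increments are
  bounded by a convergent geometric series with ratio \<open>sqrt (1 / 2)\<close>.
\<close>

lemma Cauchy_sequence_AE_convergent:
  assumes f: "\<And>n. square_integrable M (f n)"
    and small: "\<And>k. (\<integral>x. (cmod (f (Suc k) x - f k x))\<^sup>2 \<partial>M) \<le> (1 / 4) ^ k"
  shows "AE x in M. convergent (\<lambda>k. f k x)"
proof -
  define d where "d k x = f (Suc k) x - f k x" for k x
  have d: "square_integrable M (d k)" for k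
    unfolding d_def[abs_def] by (intro square_integrable_diff f)
  then have [measurable]: "d k \<in> borel_measurable M" for k by (simp add: square_integrable_def)
  have "(\<integral>\<^sup>+x. (\<Sum>k. ennreal (2 ^ k * (cmod (d k x))\<^sup>2)) \<partial>M) = (\<Sum>k. \<integral>\<^sup>+x. ennreal (2 ^ k * (cmod (d k x))\<^sup>2) \<partial>M)"
    by (rule nn_integral_suminf) measurable
  also have "\<dots> \<le> (\<Sum>k. ennreal ((1 / 2) ^ k))"
  proof (rule suminf_le)
    fix k
    have "(\<integral>\<^sup>+x. ennreal (2 ^ k * (cmod (d k x))\<^sup>2) \<partial>M) = ennreal (2 ^ k * (\<integral>x. (cmod (d k x))\<^sup>2 \<partial>M))"
      using d[of k] by (subst nn_integral_eq_integral) (auto simp: square_integrable_def)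
    also have "2 ^ k * (\<integral>x. (cmod (d k x))\<^sup>2 \<partial>M) \<le> 2 ^ k * (1 / 4) ^ k"
      using small[of k] by (simp add: d_def)
    also have "2 ^ k * (1 / 4) ^ k = (1 / 2 :: real) ^ k"
      by (simp flip: power_mult_distrib)
    finally show "(\<integral>\<^sup>+x. ennreal (2 ^ k * (cmod (d k x))\<^sup>2) \<partial>M) \<le> ennreal ((1 / 2) ^ k)"
      by (simp add: ennreal_leI)
  qed auto
  also have "\<dots> < \<infinity>"
  proof -
    have "(\<Sum>k. ennreal ((1 / 2) ^ k)) = ennreal (\<Sum>k. (1 / 2) ^ k)"
      by (rule suminf_ennreal2) (simp_all only: summable_geometric_iff, simp_all)
    then show ?thesis using ennreal_less_top by (simp only: infinity_ennreal_def)
  qed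
  finally have "AE x in M. (\<Sum>k. ennreal (2 ^ k * (cmod (d k x))\<^sup>2)) \<noteq> \<infinity>"
    by (intro nn_integral_noteq_infinite) auto
  then show ?thesis
  proof eventually_elim
    case (elim x)
    have "summable (\<lambda>k. 2 ^ k * (cmod (d k x))\<^sup>2)"
      using elim by (intro summable_suminf_not_top) auto
    then have "(\<lambda>k. 2 ^ k * (cmod (d k x))\<^sup>2) \<longlonglongrightarrow> 0" by (rule summable_LIMSEQ_zero)
    then have "Bseq (\<lambda>k. 2 ^ k * (cmod (d k x))\<^sup>2)" by (intro convergent_imp_Bseq convergentI)
    then obtain H where H: "\<And>k. norm (2 ^ k * (cmod (d k x))\<^sup>2) \<le> H"
      unfolding Bseq_def by blast
    have "cmod (d k x) \<le> sqrt H * (sqrt (1 / 2)) ^ k" for k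
    proof -
      have "(cmod (d k x))\<^sup>2 \<le> H * (1 / 2) ^ k"
        using H[of k] by (simp add: field_simps)
      then have "cmod (d k x) \<le> sqrt (H * (1 / 2) ^ k)"
        by (simp add: real_le_rsqrt)
      then show ?thesis by (simp add: real_sqrt_mult real_sqrt_power real_sqrt_divide)
    qed
    moreover have "summable (\<lambda>k. sqrt H * (sqrt (1 / 2)) ^ k)"
      by (intro summable_mult summable_geometric) (simp add: real_sqrt_divide)
    ultimately have "summable (\<lambda>k. d k x)"
      using summable_comparison_test'[of "\<lambda>k. sqrt H * (sqrt (1 / 2)) ^ k" 0 "\<lambda>k. d k x"] by blast
    then have "convergent (\<lambda>n. \<Sum>k<n. d k x)" by (simp add: summable_iff_convergent)
    moreover have "(\<lambda>n. \<Sum>k<n. d k x) = (\<lambda>n. f n x - f 0 x)"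
      unfolding d_def by (rule ext) (rule sum_lessThan_telescope)
    ultimately have "convergent (\<lambda>n. f n x - f 0 x)" by simp
    then have "convergent (\<lambda>n. (f n x - f 0 x) + f 0 x)" by (intro convergent_add convergent_const)
    then show ?case by simp
  qed
qed

text \<open>
  A rapidly convergent subsequence has a limit almost everywhere, and Fatou's lemma shows that the
  whole sequence converges to it in mean square.
\<close>

lemma Riesz_Fischer:
  assumes f: "\<And>n. square_integrable M (f n)"
    and Cauchy: "\<And>e. e > 0 \<Longrightarrow> \<exists>N. \<forall>m\<ge>N. \<forall>n\<ge>N. (\<integral>x. (cmod (f m x - f n x))\<^sup>2 \<partial>M) < e"
  obtains g where "square_integrable M g" "(\<lambda>n. \<integral>x. (cmod (f n x - g x))\<^sup>2 \<partial>M) \<longlonglongrightarrow> 0"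
proof -
  have "\<forall>k. \<exists>N. \<forall>m\<ge>N. \<forall>n\<ge>N. (\<integral>x. (cmod (f m x - f n x))\<^sup>2 \<partial>M) < (1 / 4) ^ k"
    using Cauchy by simp
  then obtain N where N: "\<And>k m n. m \<ge> N k \<Longrightarrow> n \<ge> N k \<Longrightarrow> (\<integral>x. (cmod (f m x - f n x))\<^sup>2 \<partial>M) < (1 / 4) ^ k"
    by metis
  \<comment> \<open>A subsequence with \<open>r k \<ge> N k\<close>; monotonicity lets \<open>N k\<close> control the step from \<open>r k\<close> to \<open>r (Suc k)\<close>.\<close>
  define r where "r k = k + (\<Sum>i\<le>k. N i)" for k
  have r: "r k \<ge> N k" "r (Suc k) \<ge> r k" "r k \<ge> k" for k
    by (auto simp: r_def member_le_sum trans_le_add2)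
  define g where "g x = lim (\<lambda>k. f (r k) x)" for x
  have conv: "AE x in M. convergent (\<lambda>k. f (r k) x)"
  proof (rule Cauchy_sequence_AE_convergent)
    show "(\<integral>x. (cmod (f (r (Suc k)) x - f (r k) x))\<^sup>2 \<partial>M) \<le> (1 / 4) ^ k" for k
      by (rule less_imp_le, rule N[of k]) (rule r order_trans[OF r(1) r(2)])+
  qed (rule f)
  have [measurable]: "f n \<in> borel_measurable M" for n using f by (simp add: square_integrable_def)
  have g: "g \<in> borel_measurable M" unfolding g_def[abs_def] by measurable
  have close: "square_integrable M (\<lambda>x. f n x - g x) \<and> (\<integral>x. (cmod (f n x - g x))\<^sup>2 \<partial>M) \<le> e"
    if K: "\<And>m n. m \<ge> K \<Longrightarrow> n \<ge> K \<Longrightarrow> (\<integral>x. (cmod (f m x - f n x))\<^sup>2 \<partial>M) < e" and "n \<ge> K" for e K n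
  proof (rule square_integrable_Fatou)
    show "AE x in M. (\<lambda>k. f n x - f (r (k + K)) x) \<longlonglongrightarrow> f n x - g x"
      using conv
    proof eventually_elim
      case (elim x)
      then have "(\<lambda>k. f (r k) x) \<longlonglongrightarrow> g x" by (simp add: g_def convergent_LIMSEQ_iff)
      then show ?case by (intro tendsto_diff tendsto_const LIMSEQ_ignore_initial_segment)
    qed
    show "(\<integral>x. (cmod (f n x - f (r (k + K)) x))\<^sup>2 \<partial>M) \<le> e" for k
      using r(3)[of "k + K"] that(2) by (intro less_imp_le[OF K]) simp_all
  qed (use f g in \<open>auto intro: square_integrable_diff\<close>)
  show thesis
  proof (rule that)
    have "square_integrable M (\<lambda>x. f (N 0) x - g x)"
      using close[of "N 0" 1 "N 0"] N[of 0] by auto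
    from square_integrable_diff[OF f[of "N 0"] this] show "square_integrable M g" by simp
    show "(\<lambda>n. \<integral>x. (cmod (f n x - g x))\<^sup>2 \<partial>M) \<longlonglongrightarrow> 0"
    proof (rule LIMSEQ_I)
      fix e :: real assume "e > 0"
      then obtain K where K: "\<And>m n. m \<ge> K \<Longrightarrow> n \<ge> K \<Longrightarrow> (\<integral>x. (cmod (f m x - f n x))\<^sup>2 \<partial>M) < e / 2"
        using Cauchy[of "e / 2"] by auto
      have "norm ((\<integral>x. (cmod (f n x - g x))\<^sup>2 \<partial>M) - 0) < e" if "n \<ge> K" for n
        using close[OF K that] \<open>e > 0\<close> by auto
      then show "\<exists>no. \<forall>n\<ge>no. norm ((\<integral>x. (cmod (f n x - g x))\<^sup>2 \<partial>M) - 0) < e" by blast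
    qed
  qed
qed

section \<open>The Laplace transform on the half-line\<close>

abbreviation lebesgue_pos :: "real measure" where
  "lebesgue_pos \<equiv> lebesgue_on {0<..}"

lemma L2_pos_iff: "f \<in> L2_pos \<longleftrightarrow> square_integrable lebesgue_pos f"
  by (simp add: L2_pos_def square_integrable_def)

lemma L2_norm_sq: "(L2_norm f)\<^sup>2 = (\<integral>t. (cmod (f t))\<^sup>2 \<partial>lebesgue_pos)"
  by (simp add: L2_norm_def)

lemma borel_measurable_lebesgue_pos:
  assumes "f \<in> borel_measurable borel"
  shows "f \<in> borel_measurable lebesgue_pos"
  using assms by (intro measurable_restrict_space1 measurable_completion) simp

text \<open>
  This uses completeness of Lebesgue measure. It makes the domain of the form invariant under
  changes on null sets, although those may destroy Borel measurability.
\<close>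

lemma borel_measurable_lebesgue_pos_AE:
  fixes f g :: "real \<Rightarrow> complex"
  assumes f: "f \<in> borel_measurable lebesgue_pos" and ae: "AE t in lebesgue_pos. f t = g t"
  shows "g \<in> borel_measurable lebesgue_pos"
proof -
  have "(\<lambda>t. indicator {0<..} t *\<^sub>R f t) \<in> borel_measurable lebesgue"
    using f by (simp add: borel_measurable_restrict_space_iff)
  moreover have "AE t in lebesgue. indicator {0<..} t *\<^sub>R f t = indicator {0<..} t *\<^sub>R g t"
    using ae by (subst (asm) AE_restrict_space_iff) (auto elim!: AE_mp simp: indicator_def)
  ultimately have "(\<lambda>t. indicator {0<..} t *\<^sub>R g t) \<in> borel_measurable lebesgue"
    by (rule borel_measurable_AE)
  then show ?thesis by (simp add: borel_measurable_restrict_space_iff)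
qed

lemma exp_kernel:
  assumes "x > 0"
  shows "integrable lebesgue_pos (\<lambda>t. exp (- t * x))" "(\<integral>t. exp (- t * x) \<partial>lebesgue_pos) = 1 / x"
proof -
  have "((\<lambda>t. exp (- x * t)) has_integral 1 / x) {0..}"
    using has_integral_exp_minus_to_infinity[OF assms, of 0] by simp
  then have I: "((\<lambda>t. exp (- t * x)) has_integral 1 / x) {0<..}"
  proof (subst has_integral_spike_set_eq[of _ "{0..}"])
    show "negligible {t \<in> {0<..} - {0..}. exp (- t * x) \<noteq> 0}" by (rule negligible_subset[of "{}"]) auto
    show "negligible {t \<in> {0..} - {0<..}. exp (- t * x) \<noteq> 0}" by (rule negligible_subset[of "{0}"]) auto
  qed (simp add: mult.commute)
  then have "(\<lambda>t. exp (- t * x)) absolutely_integrable_on {0<..}"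
    by (intro nonnegative_absolutely_integrable_1) (auto simp: has_integral_iff)
  then show *: "integrable lebesgue_pos (\<lambda>t. exp (- t * x))"
    by (rule absolutely_integrable_imp_integrable) simp
  show "(\<integral>t. exp (- t * x) \<partial>lebesgue_pos) = 1 / x"
    using lebesgue_integral_eq_integral[OF *] I by (simp add: has_integral_iff)
qed

lemma square_integrable_exp_kernel:
  assumes "x > 0"
  shows "square_integrable lebesgue_pos (\<lambda>t. complex_of_real (exp (- t * x)))"
    and "(\<integral>t. (cmod (complex_of_real (exp (- t * x))))\<^sup>2 \<partial>lebesgue_pos) = 1 / (2 * x)"
proof -
  have sq: "(\<lambda>t. (cmod (complex_of_real (exp (- t * x))))\<^sup>2) = (\<lambda>t. exp (- t * (2 * x)))"
    by (simp add: fun_eq_iff flip: exp_double)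
  have "(\<lambda>t. complex_of_real (exp (- t * x))) \<in> borel_measurable lebesgue_pos"
    by (rule borel_measurable_lebesgue_pos) measurable
  then show "square_integrable lebesgue_pos (\<lambda>t. complex_of_real (exp (- t * x)))"
    unfolding square_integrable_def sq using exp_kernel(1)[of "2 * x"] assms by simp
  show "(\<integral>t. (cmod (complex_of_real (exp (- t * x))))\<^sup>2 \<partial>lebesgue_pos) = 1 / (2 * x)"
    unfolding sq using assms exp_kernel(2)[of "2 * x"] by simp
qed

lemma laplace_integrable:
  assumes "square_integrable lebesgue_pos f" "x > 0"
  shows "integrable lebesgue_pos (\<lambda>t. complex_of_real (exp (- t * x)) * f t)"
  using assms by (intro square_integrable_mult square_integrable_exp_kernel)

text \<open>
  The kernel \<open>exp (- t * x)\<close> has squared $L^2$ norm \<open>1 / (2 * x)\<close>. So point evaluations of the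
  transform are continuous on $L^2$, but not uniformly as \<open>x\<close> tends to zero; this singularity is
  the source of all difficulties in the proof of density.
\<close>

lemma laplace_bound:
  assumes "square_integrable lebesgue_pos f" "x > 0"
  shows "(cmod (laplace f x))\<^sup>2 \<le> (\<integral>t. (cmod (f t))\<^sup>2 \<partial>lebesgue_pos) / (2 * x)"
  using Cauchy_Schwarz_integral[OF square_integrable_exp_kernel(1)[OF assms(2)] assms(1)]
  unfolding square_integrable_exp_kernel(2)[OF assms(2)] laplace_def by simp

lemma laplace_add:
  assumes "square_integrable lebesgue_pos f" "square_integrable lebesgue_pos g" "x > 0"
  shows "laplace (\<lambda>t. f t + g t) x = laplace f x + laplace g x"
  using laplace_integrable[OF assms(1,3)] laplace_integrable[OF assms(2,3)]
  by (simp add: laplace_def distrib_left)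

lemma laplace_diff:
  assumes "square_integrable lebesgue_pos f" "square_integrable lebesgue_pos g" "x > 0"
  shows "laplace (\<lambda>t. f t - g t) x = laplace f x - laplace g x"
  using laplace_integrable[OF assms(1,3)] laplace_integrable[OF assms(2,3)]
  by (simp add: laplace_def right_diff_distrib)

lemma laplace_cmult: "laplace (\<lambda>t. c * f t) x = c * laplace f x"
  unfolding laplace_def by (simp add: mult.left_commute)

lemma laplace_cong_AE:
  assumes "f \<in> borel_measurable lebesgue_pos" "AE t in lebesgue_pos. f t = g t"
  shows "laplace f x = laplace g x"
proof -
  have "(\<lambda>t. complex_of_real (exp (- t * x))) \<in> borel_measurable lebesgue_pos"
    by (rule borel_measurable_lebesgue_pos) measurable
  then show ?thesis unfolding laplace_def
    using assms borel_measurable_lebesgue_pos_AE[OF assms]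
    by (intro integral_cong_AE) (auto intro: borel_measurable_times elim: AE_mp)
qed

text \<open>
  Needed only for measurability of the transform with respect to \<open>\<mu>\<close>.
\<close>

lemma continuous_on_laplace:
  assumes f: "square_integrable lebesgue_pos f"
  shows "continuous_on {0<..} (laplace f)"
  unfolding continuous_on_sequentially
proof (intro allI ballI impI)
  fix X :: "nat \<Rightarrow> real" and a :: real
  assume "a \<in> {0<..}" and "(\<forall>n. X n \<in> {0<..}) \<and> X \<longlonglongrightarrow> a"
  then have a: "a > 0" and X: "\<And>n. X n > 0" "X \<longlonglongrightarrow> a" by auto
  have "\<forall>\<^sub>F n in sequentially. X n > a / 2"
    using X(2) a by (intro order_tendstoD) auto
  then obtain N where N: "\<And>n. n \<ge> N \<Longrightarrow> X n > a / 2"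
    by (auto simp: eventually_sequentially)
  have "(\<lambda>n. laplace f (X (n + N))) \<longlonglongrightarrow> laplace f a"
    unfolding laplace_def
  proof (rule integral_dominated_convergence[where w = "\<lambda>t. cmod (complex_of_real (exp (- t * (a / 2))) * f t)"])
    show "integrable lebesgue_pos (\<lambda>t. cmod (complex_of_real (exp (- t * (a / 2))) * f t))"
      using laplace_integrable[OF f, of "a / 2"] a by (intro integrable_norm) simp
    show "AE t in lebesgue_pos. (\<lambda>n. complex_of_real (exp (- t * X (n + N))) * f t)
        \<longlonglongrightarrow> complex_of_real (exp (- t * a)) * f t"
      by (intro AE_I2 tendsto_intros LIMSEQ_ignore_initial_segment X)
    show "AE t in lebesgue_pos. norm (complex_of_real (exp (- t * X (n + N))) * f t)
        \<le> cmod (complex_of_real (exp (- t * (a / 2))) * f t)" for n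
    proof (rule AE_I2)
      fix t assume "t \<in> space lebesgue_pos"
      then have "t * (a / 2) \<le> t * X (n + N)"
        using N[of "n + N"] by (intro mult_left_mono) auto
      then show "norm (complex_of_real (exp (- t * X (n + N))) * f t)
        \<le> cmod (complex_of_real (exp (- t * (a / 2))) * f t)"
        by (auto simp: norm_mult intro!: mult_right_mono)
    qed
  qed (use laplace_integrable[OF f] X a in \<open>auto intro!: borel_measurable_integrable\<close>)
  then have "(\<lambda>n. laplace f (X n)) \<longlonglongrightarrow> laplace f a" by (rule LIMSEQ_offset)
  then show "(laplace f \<circ> X) \<longlonglongrightarrow> laplace f a" by (simp add: o_def)
qed

section \<open>The form as a closed quadratic form\<close>

text \<open>
  Extension of the transform by zero, so that integrals over \<open>{0<..}\<close> become integrals over the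
  whole space and the facts about square-integrable functions apply to \<open>\<mu>\<close> itself.
\<close>

definition laplace_pos :: "(real \<Rightarrow> complex) \<Rightarrow> real \<Rightarrow> complex" where
  "laplace_pos f x = indicator {0<..} x *\<^sub>R laplace f x"

lemma laplace_pos_measurable:
  assumes "\<mu> \<in> class_M" "square_integrable lebesgue_pos f"
  shows "laplace_pos f \<in> borel_measurable \<mu>"
proof -
  have "laplace_pos f \<in> borel_measurable borel"
    unfolding laplace_pos_def[abs_def]
    by (intro borel_measurable_continuous_on_indicator continuous_on_laplace assms) simp
  moreover have "sets \<mu> = sets borel" using assms(1) by (simp add: class_M_def)
  ultimately show ?thesis by (simp cong: measurable_cong_sets)
qed

lemma cmod_laplace_pos_sq: "(cmod (laplace_pos f x))\<^sup>2 = indicator {0<..} x *\<^sub>R (cmod (laplace f x))\<^sup>2"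
  by (simp add: laplace_pos_def indicator_def)

lemma Q_form_eq: "Q_form \<mu> f = (\<integral>x. (cmod (laplace_pos f x))\<^sup>2 \<partial>\<mu>)"
  by (simp only: Q_form_def set_lebesgue_integral_def cmod_laplace_pos_sq)

lemma Dom_Q_iff:
  assumes "\<mu> \<in> class_M"
  shows "f \<in> Dom_Q \<mu> \<longleftrightarrow> square_integrable lebesgue_pos f \<and> square_integrable \<mu> (laplace_pos f)"
  using laplace_pos_measurable[OF assms, of f]
  by (auto simp: Dom_Q_def L2_pos_iff square_integrable_def set_integrable_def cmod_laplace_pos_sq)

lemma laplace_pos_add:
  assumes "square_integrable lebesgue_pos f" "square_integrable lebesgue_pos g"
  shows "laplace_pos (\<lambda>t. f t + g t) = (\<lambda>x. laplace_pos f x + laplace_pos g x)"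
  using laplace_add[OF assms] by (auto simp: laplace_pos_def indicator_def)

lemma laplace_pos_diff:
  assumes "square_integrable lebesgue_pos f" "square_integrable lebesgue_pos g"
  shows "laplace_pos (\<lambda>t. f t - g t) = (\<lambda>x. laplace_pos f x - laplace_pos g x)"
  using laplace_diff[OF assms] by (auto simp: laplace_pos_def indicator_def)

lemma laplace_pos_cmult: "laplace_pos (\<lambda>t. c * f t) = (\<lambda>x. c * laplace_pos f x)"
  by (auto simp: laplace_pos_def laplace_cmult indicator_def)

lemma laplace_pos_cong_AE:
  assumes "f \<in> borel_measurable lebesgue_pos" "AE t in lebesgue_pos. f t = g t"
  shows "laplace_pos f = laplace_pos g"
  by (simp add: laplace_pos_def laplace_cong_AE[OF assms] fun_eq_iff)

text \<open>
  The square of the form norm. Unlike the norm it needs no square roots, and the crude inequality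
  \<open>energy (f + g) \<le> 2 * energy f + 2 * energy g\<close> replaces the triangle inequality.
\<close>

definition energy :: "real measure \<Rightarrow> (real \<Rightarrow> complex) \<Rightarrow> real" where
  "energy \<mu> f = (\<integral>t. (cmod (f t))\<^sup>2 \<partial>lebesgue_pos) + (\<integral>x. (cmod (laplace_pos f x))\<^sup>2 \<partial>\<mu>)"

lemma form_norm_eq: "form_norm (Q_form \<mu>) f = sqrt (energy \<mu> f)"
  by (simp add: form_norm_def energy_def L2_norm_sq Q_form_eq)

lemma energy_nonneg: "energy \<mu> f \<ge> 0" by (simp add: energy_def)

lemma Dom_Q_add: "\<mu> \<in> class_M \<Longrightarrow> f \<in> Dom_Q \<mu> \<Longrightarrow> g \<in> Dom_Q \<mu> \<Longrightarrow> (\<lambda>t. f t + g t) \<in> Dom_Q \<mu>"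
  by (simp add: Dom_Q_iff laplace_pos_add square_integrable_add)

lemma Dom_Q_diff: "\<mu> \<in> class_M \<Longrightarrow> f \<in> Dom_Q \<mu> \<Longrightarrow> g \<in> Dom_Q \<mu> \<Longrightarrow> (\<lambda>t. f t - g t) \<in> Dom_Q \<mu>"
  by (simp add: Dom_Q_iff laplace_pos_diff square_integrable_diff)

lemma Dom_Q_cmult: "\<mu> \<in> class_M \<Longrightarrow> f \<in> Dom_Q \<mu> \<Longrightarrow> (\<lambda>t. c * f t) \<in> Dom_Q \<mu>"
  by (simp add: Dom_Q_iff laplace_pos_cmult square_integrable_cmult)

lemma energy_add_le:
  assumes "\<mu> \<in> class_M" "f \<in> Dom_Q \<mu>" "g \<in> Dom_Q \<mu>"
  shows "energy \<mu> (\<lambda>t. f t + g t) \<le> 2 * energy \<mu> f + 2 * energy \<mu> g"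
  using assms integral_sq_add_le[of lebesgue_pos f g] integral_sq_add_le[of \<mu> "laplace_pos f" "laplace_pos g"]
  by (simp add: Dom_Q_iff energy_def laplace_pos_add)

lemma energy_cmult: "energy \<mu> (\<lambda>t. c * f t) = (cmod c)\<^sup>2 * energy \<mu> f"
  by (simp add: energy_def laplace_pos_cmult norm_mult power_mult_distrib distrib_left)

lemma zero_in_Dom_Q: "\<mu> \<in> class_M \<Longrightarrow> (\<lambda>t. 0) \<in> Dom_Q \<mu>"
  using laplace_pos_cmult[of 0 "\<lambda>_. 0"] by (simp add: Dom_Q_iff square_integrable_def)

lemma Dom_Q_cong_AE:
  assumes "\<mu> \<in> class_M" "f \<in> Dom_Q \<mu>" "AE t in lebesgue_pos. f t = g t"
  shows "g \<in> Dom_Q \<mu>" "laplace_pos g = laplace_pos f"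
proof -
  have f: "square_integrable lebesgue_pos f" "square_integrable \<mu> (laplace_pos f)"
    using assms(1,2) by (auto simp: Dom_Q_iff)
  then have m: "f \<in> borel_measurable lebesgue_pos" by (simp add: square_integrable_def)
  show eq: "laplace_pos g = laplace_pos f" using laplace_pos_cong_AE[OF m assms(3)] by simp
  have "square_integrable lebesgue_pos g"
    by (rule square_integrable_cong_AE[OF f(1) borel_measurable_lebesgue_pos_AE[OF m assms(3)] assms(3)])
  then show "g \<in> Dom_Q \<mu>" using assms(1) f(2) by (simp add: Dom_Q_iff eq)
qed

text \<open>
  The sesquilinear form is \<open>\<integral> \<L>f * cnj (\<L>g)\<close>, which is defined on the domain by the
  Cauchy-Schwarz inequality.
\<close>

lemma quadratic_form_Q_form:
  assumes \<mu>: "\<mu> \<in> class_M"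
  shows "quadratic_form (Dom_Q \<mu>) (Q_form \<mu>)"
proof -
  define B where "B f g = (\<integral>x. laplace_pos f x * cnj (laplace_pos g x) \<partial>\<mu>)" for f g
  have int: "integrable \<mu> (\<lambda>x. laplace_pos f x * cnj (laplace_pos g x))"
    if "f \<in> Dom_Q \<mu>" "g \<in> Dom_Q \<mu>" for f g
  proof (rule square_integrable_mult)
    show "square_integrable \<mu> (laplace_pos f)" using that \<mu> by (simp add: Dom_Q_iff)
    have "square_integrable \<mu> (laplace_pos g)" using that \<mu> by (simp add: Dom_Q_iff)
    then show "square_integrable \<mu> (\<lambda>x. cnj (laplace_pos g x))"
      using measurable_compose[OF _ borel_measurable_continuous_onI[of cnj], of "laplace_pos g" \<mu>]
      by (simp add: square_integrable_def continuous_on_cnj)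
  qed
  have add: "laplace_pos (\<lambda>t. f t + g t) = (\<lambda>x. laplace_pos f x + laplace_pos g x)"
    if "f \<in> Dom_Q \<mu>" "g \<in> Dom_Q \<mu>" for f g
    using that \<mu> by (intro laplace_pos_add) (auto simp: Dom_Q_iff)
  have B_add: "B (\<lambda>t. f t + g t) h = B f h + B g h \<and> B h (\<lambda>t. f t + g t) = B h f + B h g"
    if "f \<in> Dom_Q \<mu>" "g \<in> Dom_Q \<mu>" "h \<in> Dom_Q \<mu>" for f g h
    unfolding B_def using that by (simp add: add int distrib_left distrib_right)
  have B_cmult: "B (\<lambda>t. c * f t) g = c * B f g \<and> B f (\<lambda>t. c * g t) = cnj c * B f g" for c f g
    unfolding B_def by (simp add: laplace_pos_cmult mult.assoc mult.left_commute[of _ "cnj c"])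
  have B_diag: "complex_of_real (Q_form \<mu> f) = B f f" for f
    unfolding B_def Q_form_eq complex_norm_square[symmetric] by (simp flip: of_real_power)
  have AE: "g \<in> Dom_Q \<mu>" "Q_form \<mu> g = Q_form \<mu> f"
    if "f \<in> Dom_Q \<mu>" "AE t in lebesgue_pos. f t = g t" for f g
    using Dom_Q_cong_AE[OF \<mu> that] by (simp_all add: Q_form_eq)
  have L2: "Dom_Q \<mu> \<subseteq> L2_pos" by (auto simp: Dom_Q_def)
  show ?thesis
    unfolding quadratic_form_def
    by (intro conjI exI[of _ B] ballI allI impI)
       (rule L2 zero_in_Dom_Q[OF \<mu>] Dom_Q_add[OF \<mu>] Dom_Q_cmult[OF \<mu>] AE
         B_add[THEN conjunct1] B_add[THEN conjunct2] B_cmult[THEN conjunct1] B_cmult[THEN conjunct2]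
         B_diag; assumption)+
qed

lemma laplace_tendsto:
  assumes s: "\<And>n. square_integrable lebesgue_pos (s n)" and f: "square_integrable lebesgue_pos f"
    and lim: "(\<lambda>n. \<integral>t. (cmod (s n t - f t))\<^sup>2 \<partial>lebesgue_pos) \<longlonglongrightarrow> 0" and "x > 0"
  shows "(\<lambda>n. laplace (s n) x) \<longlonglongrightarrow> laplace f x"
proof -
  have "(\<lambda>n. (cmod (laplace (s n) x - laplace f x))\<^sup>2) \<longlonglongrightarrow> 0"
  proof (rule tendsto_sandwich[OF _ _ tendsto_const])
    show "(\<lambda>n. (\<integral>t. (cmod (s n t - f t))\<^sup>2 \<partial>lebesgue_pos) / (2 * x)) \<longlonglongrightarrow> 0"
      using tendsto_divide[OF lim tendsto_const[of "2 * x"]] \<open>x > 0\<close> by simp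
    show "\<forall>\<^sub>F n in sequentially. (cmod (laplace (s n) x - laplace f x))\<^sup>2
        \<le> (\<integral>t. (cmod (s n t - f t))\<^sup>2 \<partial>lebesgue_pos) / (2 * x)"
      using laplace_bound[OF square_integrable_diff[OF s f] \<open>x > 0\<close>] laplace_diff[OF s f \<open>x > 0\<close>]
      by simp
  qed simp
  then have "(\<lambda>n. sqrt ((cmod (laplace (s n) x - laplace f x))\<^sup>2)) \<longlonglongrightarrow> sqrt 0"
    by (rule tendsto_real_sqrt)
  then have "(\<lambda>n. laplace (s n) x - laplace f x) \<longlonglongrightarrow> 0"
    by (simp add: tendsto_norm_zero_iff)
  then show ?thesis by (simp add: LIM_zero_iff)
qed

lemma laplace_pos_tendsto:
  assumes "\<And>n. square_integrable lebesgue_pos (s n)" "square_integrable lebesgue_pos f"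
    "(\<lambda>n. \<integral>t. (cmod (s n t - f t))\<^sup>2 \<partial>lebesgue_pos) \<longlonglongrightarrow> 0"
  shows "(\<lambda>n. laplace_pos (s n) x) \<longlonglongrightarrow> laplace_pos f x"
  using laplace_tendsto[OF assms, of x] by (cases "x > 0") (auto simp: laplace_pos_def)

text \<open>
  The $L^2$ limit \<open>g\<close> exists by Riesz-Fischer. Since $L^2$ convergence implies pointwise
  convergence of the transforms, Fatou's lemma bounds the form at \<open>f n - g\<close> by its values at
  \<open>f n - f m\<close> for large \<open>m\<close>.
\<close>

lemma Dom_Q_complete:
  assumes \<mu>: "\<mu> \<in> class_M" and f: "\<And>n. f n \<in> Dom_Q \<mu>"
    and Cauchy: "\<And>e. e > 0 \<Longrightarrow> \<exists>N. \<forall>m\<ge>N. \<forall>n\<ge>N. energy \<mu> (\<lambda>t. f m t - f n t) < e"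
  shows "\<exists>g\<in>Dom_Q \<mu>. (\<lambda>n. energy \<mu> (\<lambda>t. f n t - g t)) \<longlonglongrightarrow> 0"
proof -
  have L2: "square_integrable lebesgue_pos (f n)" for n using f \<mu> by (simp add: Dom_Q_iff)
  have parts: "(\<integral>t. (cmod (h t))\<^sup>2 \<partial>lebesgue_pos) \<le> energy \<mu> h"
    "(\<integral>x. (cmod (laplace_pos h x))\<^sup>2 \<partial>\<mu>) \<le> energy \<mu> h" for h
    by (simp_all add: energy_def)
  have "\<exists>N. \<forall>m\<ge>N. \<forall>n\<ge>N. (\<integral>t. (cmod (f m t - f n t))\<^sup>2 \<partial>lebesgue_pos) < e" if "e > 0" for e
    using Cauchy[OF that] le_less_trans[OF parts(1)] by fast
  from Riesz_Fischer[OF L2 this] obtain g where g: "square_integrable lebesgue_pos g"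
    and lim: "(\<lambda>n. \<integral>t. (cmod (f n t - g t))\<^sup>2 \<partial>lebesgue_pos) \<longlonglongrightarrow> 0"
    by blast
  have Q: "square_integrable \<mu> (laplace_pos (\<lambda>t. f n t - g t)) \<and>
      (\<integral>x. (cmod (laplace_pos (\<lambda>t. f n t - g t) x))\<^sup>2 \<partial>\<mu>) \<le> e"
    if K: "\<And>m n. m \<ge> K \<Longrightarrow> n \<ge> K \<Longrightarrow> energy \<mu> (\<lambda>t. f m t - f n t) < e" and "n \<ge> K" for e K n
  proof (rule square_integrable_Fatou)
    show "laplace_pos (\<lambda>t. f n t - g t) \<in> borel_measurable \<mu>"
      by (intro laplace_pos_measurable \<mu> square_integrable_diff L2 g)
    show "square_integrable \<mu> (laplace_pos (\<lambda>t. f n t - f (k + K) t))" for k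
      using Dom_Q_diff[OF \<mu> f f] \<mu> by (simp add: Dom_Q_iff)
    show "AE x in \<mu>. (\<lambda>k. laplace_pos (\<lambda>t. f n t - f (k + K) t) x) \<longlonglongrightarrow> laplace_pos (\<lambda>t. f n t - g t) x"
      unfolding laplace_pos_diff[OF L2 L2] laplace_pos_diff[OF L2 g]
      by (intro AE_I2 tendsto_diff tendsto_const LIMSEQ_ignore_initial_segment laplace_pos_tendsto L2 g lim)
    show "(\<integral>x. (cmod (laplace_pos (\<lambda>t. f n t - f (k + K) t) x))\<^sup>2 \<partial>\<mu>) \<le> e" for k
      by (rule order_trans[OF parts(2)], rule less_imp_le, rule K) (use that in auto)
  qed
  show ?thesis
  proof (intro bexI)
    obtain K where "\<And>m n. m \<ge> K \<Longrightarrow> n \<ge> K \<Longrightarrow> energy \<mu> (\<lambda>t. f m t - f n t) < 1"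
      using Cauchy[of 1] by auto
    from Q[OF this order_refl] have "(\<lambda>t. f K t - g t) \<in> Dom_Q \<mu>"
      using \<mu> by (simp add: Dom_Q_iff square_integrable_diff[OF L2 g])
    from Dom_Q_diff[OF \<mu> f[of K] this] show "g \<in> Dom_Q \<mu>" by simp
    have "(\<lambda>n. \<integral>x. (cmod (laplace_pos (\<lambda>t. f n t - g t) x))\<^sup>2 \<partial>\<mu>) \<longlonglongrightarrow> 0"
    proof (rule LIMSEQ_I)
      fix e :: real assume "e > 0"
      then obtain K where K: "\<And>m n. m \<ge> K \<Longrightarrow> n \<ge> K \<Longrightarrow> energy \<mu> (\<lambda>t. f m t - f n t) < e / 2"
        using Cauchy[of "e / 2"] by auto
      have "norm ((\<integral>x. (cmod (laplace_pos (\<lambda>t. f n t - g t) x))\<^sup>2 \<partial>\<mu>) - 0) < e" if "n \<ge> K" for n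
        using Q[OF K that] \<open>e > 0\<close> by auto
      then show "\<exists>no. \<forall>n\<ge>no. norm ((\<integral>x. (cmod (laplace_pos (\<lambda>t. f n t - g t) x))\<^sup>2 \<partial>\<mu>) - 0) < e" by blast
    qed
    from tendsto_add[OF lim this] show "(\<lambda>n. energy \<mu> (\<lambda>t. f n t - g t)) \<longlonglongrightarrow> 0"
      by (simp add: energy_def)
  qed
qed

lemma closed_form_Q_form:
  assumes \<mu>: "\<mu> \<in> class_M"
  shows "closed_form (Dom_Q \<mu>) (Q_form \<mu>)"
proof -
  have "\<exists>g\<in>Dom_Q \<mu>. (\<lambda>n. form_norm (Q_form \<mu>) (\<lambda>t. f n t - g t)) \<longlonglongrightarrow> 0"
    if f: "\<forall>n. f n \<in> Dom_Q \<mu>"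
      and C: "\<forall>e>0. \<exists>N. \<forall>m\<ge>N. \<forall>n\<ge>N. form_norm (Q_form \<mu>) (\<lambda>t. f m t - f n t) < e" for f
  proof -
    have "\<exists>N. \<forall>m\<ge>N. \<forall>n\<ge>N. energy \<mu> (\<lambda>t. f m t - f n t) < e" if "e > 0" for e
      using C[rule_format, of "sqrt e"] that by (simp add: form_norm_eq)
    then obtain g where "g \<in> Dom_Q \<mu>" "(\<lambda>n. energy \<mu> (\<lambda>t. f n t - g t)) \<longlonglongrightarrow> 0"
      using Dom_Q_complete[OF \<mu>, of f] f by blast
    then show ?thesis using tendsto_real_sqrt[of _ 0] by (force simp: form_norm_eq)
  qed
  moreover have "0 \<le> Q_form \<mu> f" for f by (simp add: Q_form_eq)
  ultimately show ?thesis
    using quadratic_form_Q_form[OF \<mu>] unfolding closed_form_def by blast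
qed

section \<open>Convergence in the form norm\<close>

text \<open>
  Pointwise convergence of the transforms comes for free from $L^2$ convergence, so a majorant in
  \<open>L\<^sup>2(\<mu>)\<close> is all that is needed for convergence in the form norm. Every step of the approximation
  is an instance of this lemma; the work lies in choosing approximants that have a majorant.
\<close>

lemma energy_tendsto_dominated:
  assumes \<mu>: "\<mu> \<in> class_M"
    and s: "\<And>n. square_integrable lebesgue_pos (s n)" and f: "square_integrable lebesgue_pos f"
    and lim: "(\<lambda>n. \<integral>t. (cmod (s n t - f t))\<^sup>2 \<partial>lebesgue_pos) \<longlonglongrightarrow> 0"
    and bound: "\<And>n x. x > 0 \<Longrightarrow> cmod (laplace (s n) x) \<le> G x"
    and G: "set_integrable \<mu> {0<..} (\<lambda>x. (G x)\<^sup>2)"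
  shows "f \<in> Dom_Q \<mu>" "\<And>n. s n \<in> Dom_Q \<mu>" "(\<lambda>n. energy \<mu> (\<lambda>t. s n t - f t)) \<longlonglongrightarrow> 0"
proof -
  have bd: "AE x in \<mu>. cmod (laplace_pos (s n) x) \<le> indicator {0<..} x * G x" for n
    using bound by (auto simp: laplace_pos_def indicator_def)
  have "(\<lambda>x. indicator {0<..} x *\<^sub>R (G x)\<^sup>2) = (\<lambda>x. (indicator {0<..} x * G x)\<^sup>2)"
    by (auto simp: indicator_def)
  then have Gi: "integrable \<mu> (\<lambda>x. (indicator {0<..} x * G x)\<^sup>2)"
    using G by (simp add: set_integrable_def)
  have lim': "AE x in \<mu>. (\<lambda>n. laplace_pos (s n) x) \<longlonglongrightarrow> laplace_pos f x"
    by (intro AE_I2 laplace_pos_tendsto s f lim)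
  note D = square_integrable_dominated[OF laplace_pos_measurable[OF \<mu> f]
      laplace_pos_measurable[OF \<mu> s] lim' bd Gi]
  show "f \<in> Dom_Q \<mu>" "s n \<in> Dom_Q \<mu>" for n using D(1,2) s f \<mu> by (simp_all add: Dom_Q_iff)
  show "(\<lambda>n. energy \<mu> (\<lambda>t. s n t - f t)) \<longlonglongrightarrow> 0"
    using tendsto_add[OF lim D(3)] by (simp add: energy_def laplace_pos_diff[OF s f])
qed

section \<open>Smooth bumps\<close>

definition bump_poly :: "real \<Rightarrow> real \<Rightarrow> real poly" where
  "bump_poly a b = [:- (a * b), a + b, -1:]"

text \<open>
  With \<open>w = (t - a) * (b - t)\<close> these are the functions \<open>p / w ^ k * exp (- c / w)\<close>, extended by
  zero. For fixed \<open>a\<close>, \<open>b\<close>, \<open>c\<close> this family is closed under differentiation, so it contains all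
  derivatives of \<open>exp (- c / w)\<close>.
\<close>

definition bump_deriv :: "real \<Rightarrow> real \<Rightarrow> real \<Rightarrow> real poly \<Rightarrow> nat \<Rightarrow> real \<Rightarrow> real" where
  "bump_deriv c a b p k t =
     (if t \<in> {a<..<b} then poly p t / poly (bump_poly a b) t ^ k * exp (- c / poly (bump_poly a b) t) else 0)"

lemma poly_bump_poly: "poly (bump_poly a b) t = (t - a) * (b - t)"
  by (simp add: bump_poly_def algebra_simps)

text \<open>
  The exponential beats every power of \<open>w\<close>. The remaining factor \<open>w\<^sup>2\<close> is what makes the
  derivatives at the end points vanish.
\<close>

lemma bump_deriv_bound:
  assumes "c > 0"
  obtains K where "K \<ge> 0" "\<And>t. t \<in> {a<..<b} \<Longrightarrow> \<bar>bump_deriv c a b p k t\<bar> \<le> K * ((t - a) * (b - t))\<^sup>2"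
proof -
  have "bounded (poly p ` {a..b})"
    by (intro compact_imp_bounded compact_continuous_image continuous_on_poly continuous_on_id compact_Icc)
  then obtain B where "\<forall>y\<in>poly p ` {a..b}. norm y \<le> B"
    unfolding bounded_iff by blast
  then have B: "\<And>t. t \<in> {a..b} \<Longrightarrow> \<bar>poly p t\<bar> \<le> B" by auto
  \<comment> \<open>From \<open>(c / (w * m)) ^ m \<le> exp (c / w)\<close>: of the \<open>k + 2\<close> powers of \<open>w\<close> gained, \<open>k\<close> cancel the denominator.\<close>
  define m where "m = k + 2"
  define K where "K = \<bar>B\<bar> * (real m / c) ^ m"
  show thesis
  proof
    show "K \<ge> 0" using assms by (simp add: K_def)
    fix t assume t: "t \<in> {a<..<b}"
    define w where "w = (t - a) * (b - t)"
    have w: "w > 0" using t by (simp add: w_def)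
    have "(c / w / m) ^ m \<le> (1 + c / w / m) ^ m"
      using w assms by (intro power_mono) auto
    also have "\<dots> \<le> exp (c / w)"
    proof (rule exp_ge_one_plus_x_over_n_power_n)
      have "0 \<le> c / w" using w assms by simp
      then show "- real m \<le> c / w" by linarith
    qed (simp add: m_def)
    finally have "inverse (exp (c / w)) \<le> inverse ((c / w / m) ^ m)"
      using w assms by (intro le_imp_inverse_le) (auto simp: m_def)
    also have "\<dots> = (m / c) ^ m * w ^ m"
      by (simp add: field_simps)
    finally have e: "exp (- c / w) \<le> (m / c) ^ m * w ^ m"
      by (simp add: exp_minus[symmetric])
    have "\<bar>bump_deriv c a b p k t\<bar> = \<bar>poly p t\<bar> / w ^ k * exp (- c / w)"
      using t w by (simp add: bump_deriv_def poly_bump_poly abs_mult flip: w_def)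
    also have "\<dots> \<le> \<bar>B\<bar> / w ^ k * ((m / c) ^ m * w ^ m)"
      using B[of t] t w e by (intro mult_mono divide_right_mono) auto
    also have "\<dots> = K * w\<^sup>2"
    proof -
      have "w ^ m = w ^ k * w\<^sup>2" by (simp add: m_def power_add power2_eq_square)
      then have "w ^ m / w ^ k = w\<^sup>2" using w by simp
      moreover have "\<bar>B\<bar> / w ^ k * ((m / c) ^ m * w ^ m) = K * (w ^ m / w ^ k)" by (simp add: K_def)
      ultimately show ?thesis by simp
    qed
    finally show "\<bar>bump_deriv c a b p k t\<bar> \<le> K * ((t - a) * (b - t))\<^sup>2" by (simp add: w_def)
  qed
qed

lemma has_real_derivative_zero_quadratic:
  fixes f :: "real \<Rightarrow> real"
  assumes "\<And>t. \<bar>f t - f t0\<bar> \<le> K * (t - t0)\<^sup>2"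
  shows "(f has_real_derivative 0) (at t0)"
  unfolding DERIV_def
proof (rule Lim_null_comparison)
  show "\<forall>\<^sub>F h in at 0. norm ((f (t0 + h) - f t0) / h) \<le> K * \<bar>h\<bar>"
  proof (rule eventually_at_filter[THEN iffD2, OF always_eventually], intro allI impI)
    fix h :: real assume "h \<noteq> 0"
    then have "\<bar>f (t0 + h) - f t0\<bar> / \<bar>h\<bar> \<le> K * h\<^sup>2 / \<bar>h\<bar>"
      using assms[of "t0 + h"] by (intro divide_right_mono) auto
    also have "\<dots> = K * \<bar>h\<bar>" using \<open>h \<noteq> 0\<close> by (simp add: power2_eq_square abs_if)
    finally show "norm ((f (t0 + h) - f t0) / h) \<le> K * \<bar>h\<bar>" by simp
  qed
  show "((\<lambda>h. K * \<bar>h\<bar>) \<longlongrightarrow> 0) (at 0)"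
    by (auto intro!: tendsto_eq_intros)
qed

lemma bump_deriv_has_derivative:
  fixes a b c :: real
  assumes "c > 0"
  defines "W \<equiv> bump_poly a b"
  shows "(bump_deriv c a b p k has_real_derivative
     bump_deriv c a b (pderiv p * W\<^sup>2 - smult (real k) (p * pderiv W * W) + smult c (p * pderiv W)) (k + 2) t) (at t)"
proof (cases "t \<in> {a<..<b}")
  case True
  define w where "w = poly W t"
  have w: "w > 0" using True by (simp add: w_def W_def poly_bump_poly)
  have dW: "(poly W has_real_derivative poly (pderiv W) t) (at t)"
    and dp: "(poly p has_real_derivative poly (pderiv p) t) (at t)" by (rule poly_DERIV)+
  have "((\<lambda>t. poly W t ^ k) has_real_derivative real k * (poly (pderiv W) t * w ^ (k - Suc 0))) (at t)"
    using DERIV_power[OF dW, of k] by (simp add: w_def)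
  moreover have "real k * (poly (pderiv W) t * w ^ (k - Suc 0)) = real k * poly (pderiv W) t * w ^ k / w"
    using w by (cases k) auto
  ultimately have "((\<lambda>t. poly W t ^ k) has_real_derivative real k * poly (pderiv W) t * w ^ k / w) (at t)"
    by simp
  from DERIV_divide[OF dp this]
  have d1: "((\<lambda>t. poly p t / poly W t ^ k) has_real_derivative
      (poly (pderiv p) t * w ^ k - poly p t * (real k * poly (pderiv W) t * w ^ k / w)) / (w ^ k * w ^ k)) (at t)"
    using w by (simp add: w_def)
  have "((\<lambda>t. - c / poly W t) has_real_derivative c * poly (pderiv W) t / (w * w)) (at t)"
    using DERIV_divide[OF DERIV_const[of "- c"] dW] w by (simp add: w_def)
  then have d2: "((\<lambda>t. exp (- c / poly W t)) has_real_derivative exp (- c / w) * (c * poly (pderiv W) t / (w * w))) (at t)"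
    using DERIV_fun_exp by (fastforce simp: w_def)
  have "((\<lambda>t. poly p t / poly W t ^ k * exp (- c / poly W t)) has_real_derivative
     bump_deriv c a b (pderiv p * W\<^sup>2 - smult (real k) (p * pderiv W * W) + smult c (p * pderiv W)) (k + 2) t) (at t)"
  proof (rule DERIV_cong[OF DERIV_mult[OF d1 d2]])
    have "bump_deriv c a b (pderiv p * W\<^sup>2 - smult (real k) (p * pderiv W * W) + smult c (p * pderiv W)) (k + 2) t
      = (poly (pderiv p) t * w\<^sup>2 - real k * (poly p t * poly (pderiv W) t * w) + c * (poly p t * poly (pderiv W) t))
         / w ^ (k + 2) * exp (- c / w)"
      using True by (simp add: bump_deriv_def w_def W_def poly_power)
    also have "\<dots> = (poly (pderiv p) t * w ^ k - poly p t * (real k * poly (pderiv W) t * w ^ k / w)) / (w ^ k * w ^ k)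
        * exp (- c / w) + exp (- c / w) * (c * poly (pderiv W) t / (w * w)) * (poly p t / w ^ k)"
      using w by (simp add: field_simps power_add power2_eq_square)
    finally show "(poly (pderiv p) t * w ^ k - poly p t * (real k * poly (pderiv W) t * w ^ k / w)) / (w ^ k * w ^ k)
        * exp (- c / poly W t) + exp (- c / w) * (c * poly (pderiv W) t / (w * w)) * (poly p t / poly W t ^ k)
      = bump_deriv c a b (pderiv p * W\<^sup>2 - smult (real k) (p * pderiv W * W) + smult c (p * pderiv W)) (k + 2) t"
      by (simp add: w_def)
  qed
  then show ?thesis
    by (rule has_field_derivative_transform_within_open[of _ _ _ "{a<..<b}"])
       (use True in \<open>auto simp: bump_deriv_def W_def\<close>)
next
  case False
  obtain K where K: "K \<ge> 0" "\<And>t. t \<in> {a<..<b} \<Longrightarrow> \<bar>bump_deriv c a b p k t\<bar> \<le> K * ((t - a) * (b - t))\<^sup>2"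
    using bump_deriv_bound[OF assms(1)] by metis
  have "(bump_deriv c a b p k has_real_derivative 0) (at t)"
  proof (rule has_real_derivative_zero_quadratic)
    fix u
    show "\<bar>bump_deriv c a b p k u - bump_deriv c a b p k t\<bar> \<le> (K * (b - a)\<^sup>2) * (u - t)\<^sup>2"
    proof (cases "u \<in> {a<..<b}")
      case True
      have "(u - a) * (b - u) \<le> (b - a) * \<bar>u - t\<bar>"
      proof (cases "t \<le> a")
        case True
        then have "(b - u) * (u - a) \<le> (b - a) * \<bar>u - t\<bar>"
          using \<open>u \<in> {a<..<b}\<close> by (intro mult_mono) auto
        then show ?thesis by (simp add: mult.commute)
      next
        case f: False
        then show ?thesis using False \<open>u \<in> {a<..<b}\<close> by (intro mult_mono) auto
      qed
      then have "((u - a) * (b - u))\<^sup>2 \<le> ((b - a) * \<bar>u - t\<bar>)\<^sup>2"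
        using True by (intro power_mono) auto
      then have "K * ((u - a) * (b - u))\<^sup>2 \<le> (K * (b - a)\<^sup>2) * (u - t)\<^sup>2"
        using K(1) by (simp add: power_mult_distrib mult_left_mono mult.assoc)
      moreover have "bump_deriv c a b p k t = 0" using False by (auto simp: bump_deriv_def)
      ultimately show ?thesis using K(2)[OF True] by simp
    qed (use False K(1) in \<open>auto simp: bump_deriv_def\<close>)
  qed
  moreover have "bump_deriv c a b q j t = 0" for q j using False by (auto simp: bump_deriv_def)
  ultimately show ?thesis by simp
qed


text \<open>
  The polynomial \<open>p\<close> for which the \<open>n\<close>-th derivative of \<open>exp (- c / w)\<close> is
  \<open>p / w ^ (2 * n) * exp (- c / w)\<close>.
\<close>

primrec bump_iter_poly :: "real \<Rightarrow> real \<Rightarrow> real \<Rightarrow> nat \<Rightarrow> real poly" where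
  "bump_iter_poly c a b 0 = 1"
| "bump_iter_poly c a b (Suc n) = pderiv (bump_iter_poly c a b n) * (bump_poly a b)\<^sup>2
     - smult (real (2 * n)) (bump_iter_poly c a b n * pderiv (bump_poly a b) * bump_poly a b)
     + smult c (bump_iter_poly c a b n * pderiv (bump_poly a b))"

text \<open>
  As \<open>c > 0\<close> tends to zero these functions tend to the indicator of \<open>{a<..<b}\<close>, with values in \<open>{0..1}\<close>.
\<close>

definition bump :: "real \<Rightarrow> real \<Rightarrow> real \<Rightarrow> real \<Rightarrow> complex" where
  "bump c a b t = (if t \<in> {a<..<b} then complex_of_real (exp (- c / ((t - a) * (b - t)))) else 0)"

lemma Cinf_compI:
  assumes "F 0 = f" "\<And>n t. t > 0 \<Longrightarrow> (F n has_vector_derivative F (Suc n) t) (at t)"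
    and "0 < a" "\<And>t. t > 0 \<Longrightarrow> f t \<noteq> 0 \<Longrightarrow> t \<in> {a..b}"
  shows "f \<in> Cinf_comp"
proof -
  have sub: "closure {t \<in> {0<..}. f t \<noteq> 0} \<subseteq> {a..b}"
    by (rule closure_minimal) (use assms(4) in auto)
  have "compact (closure {t \<in> {0<..}. f t \<noteq> 0})"
    using sub bounded_subset[OF bounded_closed_interval sub] by (simp add: compact_eq_bounded_closed)
  moreover have "closure {t \<in> {0<..}. f t \<noteq> 0} \<subseteq> {0<..}"
    using sub \<open>0 < a\<close> by force
  ultimately show ?thesis using assms(1,2) by (auto simp: Cinf_comp_def)
qed

lemma Cinf_compE:
  assumes "f \<in> Cinf_comp"
  obtains F a b where "F 0 = f" "\<And>n t. t > 0 \<Longrightarrow> (F n has_vector_derivative F (Suc n) t) (at t)"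
    "0 < a" "\<And>t. t > 0 \<Longrightarrow> f t \<noteq> 0 \<Longrightarrow> t \<in> {a..b}"
proof -
  define S where "S = closure {t \<in> {0<..}. f t \<noteq> 0}"
  obtain F where F: "F 0 = f" "\<And>n t. t > 0 \<Longrightarrow> (F n has_vector_derivative F (Suc n) t) (at t)"
    and S: "compact S" "S \<subseteq> {0<..}"
    using assms by (auto simp: Cinf_comp_def S_def)
  have in_S: "t \<in> S" if "t > 0" "f t \<noteq> 0" for t
    using that closure_subset[of "{t \<in> {0<..}. f t \<noteq> 0}"] by (auto simp: S_def)
  show thesis
  proof (cases "S = {}")
    case True
    then show thesis using that[OF F, of 1 1] in_S by auto
  next
    case False
    obtain a where a: "a \<in> S" "\<And>t. t \<in> S \<Longrightarrow> a \<le> t" using compact_attains_inf[OF S(1) False] by blast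
    obtain b where b: "b \<in> S" "\<And>t. t \<in> S \<Longrightarrow> t \<le> b" using compact_attains_sup[OF S(1) False] by blast
    show thesis using that[OF F, of a b] a b in_S S(2) by auto
  qed
qed

lemma bump_in_Cinf_comp:
  assumes "c > 0" "a > 0"
  shows "bump c a b \<in> Cinf_comp"
proof (rule Cinf_compI)
  define F where "F n t = complex_of_real (bump_deriv c a b (bump_iter_poly c a b n) (2 * n) t)" for n t
  show "F 0 = bump c a b"
    by (auto simp: F_def bump_deriv_def bump_def fun_eq_iff poly_bump_poly)
  show "(F n has_vector_derivative F (Suc n) t) (at t)" for n t
    using bump_deriv_has_derivative[OF assms(1), of a b "bump_iter_poly c a b n" "2 * n" t]
    unfolding F_def by (intro has_vector_derivative_of_real) (simp add: has_real_derivative_iff_has_vector_derivative)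
  show "t \<in> {a..b}" if "bump c a b t \<noteq> 0" for t using that by (auto simp: bump_def split: if_splits)
qed (fact assms)

lemma zero_in_Cinf_comp: "(\<lambda>t. 0) \<in> Cinf_comp"
  by (rule Cinf_compI[where F = "\<lambda>n t. 0" and a = 1 and b = 1]) auto

lemma Cinf_comp_add:
  assumes "f \<in> Cinf_comp" "g \<in> Cinf_comp"
  shows "(\<lambda>t. f t + g t) \<in> Cinf_comp"
proof -
  obtain F a b where F: "F 0 = f" "\<And>n t. t > 0 \<Longrightarrow> (F n has_vector_derivative F (Suc n) t) (at t)"
    "0 < a" "\<And>t. t > 0 \<Longrightarrow> f t \<noteq> 0 \<Longrightarrow> t \<in> {a..b}" using Cinf_compE[OF assms(1)] by metis
  obtain G c d where G: "G 0 = g" "\<And>n t. t > 0 \<Longrightarrow> (G n has_vector_derivative G (Suc n) t) (at t)"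
    "0 < c" "\<And>t. t > 0 \<Longrightarrow> g t \<noteq> 0 \<Longrightarrow> t \<in> {c..d}" using Cinf_compE[OF assms(2)] by metis
  show ?thesis
  proof (rule Cinf_compI)
    show "(\<lambda>t. F 0 t + G 0 t) = (\<lambda>t. f t + g t)" using F(1) G(1) by simp
    show "((\<lambda>t. F n t + G n t) has_vector_derivative F (Suc n) t + G (Suc n) t) (at t)" if "t > 0" for n t
      by (intro has_vector_derivative_add F(2) G(2) that)
    show "0 < min a c" using F(3) G(3) by simp
    show "t \<in> {min a c..max b d}" if "t > 0" "f t + g t \<noteq> 0" for t
      using F(4)[OF that(1)] G(4)[OF that(1)] that(2) by (cases "f t = 0") auto
  qed
qed

lemma Cinf_comp_cmult:
  assumes "f \<in> Cinf_comp"
  shows "(\<lambda>t. c * f t) \<in> Cinf_comp"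
proof -
  obtain F a b where F: "F 0 = f" "\<And>n t. t > 0 \<Longrightarrow> (F n has_vector_derivative F (Suc n) t) (at t)"
    "0 < a" "\<And>t. t > 0 \<Longrightarrow> f t \<noteq> 0 \<Longrightarrow> t \<in> {a..b}" using Cinf_compE[OF assms(1)] by metis
  show ?thesis
  proof (rule Cinf_compI)
    show "(\<lambda>t. c * F 0 t) = (\<lambda>t. c * f t)" using F(1) by simp
    show "((\<lambda>t. c * F n t) has_vector_derivative c * F (Suc n) t) (at t)" if "t > 0" for n t
      by (intro has_vector_derivative_mult_right F(2) that)
    show "0 < a" by fact
    show "t \<in> {a..b}" if "t > 0" "c * f t \<noteq> 0" for t using F(4)[OF that(1)] that(2) by simp
  qed
qed

lemma Cinf_comp_continuous_on:
  assumes "f \<in> Cinf_comp"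
  shows "continuous_on {0<..} f"
proof -
  obtain F where F: "F 0 = f" "\<And>n t. t > 0 \<Longrightarrow> (F n has_vector_derivative F (Suc n) t) (at t)"
    using Cinf_compE[OF assms] by metis
  have "isCont f t" if "t > 0" for t
    using has_vector_derivative_continuous[OF F(2)[OF that, of 0]] F(1) by simp
  then show ?thesis by (intro continuous_at_imp_continuous_on) auto
qed

lemma Cinf_comp_bound:
  assumes "f \<in> Cinf_comp"
  obtains a b C where "0 < a" "\<And>t. t > 0 \<Longrightarrow> cmod (f t) \<le> C * indicator {a..b} t"
proof -
  obtain F a b where F: "0 < a" "\<And>t. t > 0 \<Longrightarrow> f t \<noteq> 0 \<Longrightarrow> t \<in> {a..b}" using Cinf_compE[OF assms] by metis
  have "continuous_on {a..b} f"
    using F(1) by (intro continuous_on_subset[OF Cinf_comp_continuous_on[OF assms]]) auto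
  then have "bounded (f ` {a..b})" by (intro compact_imp_bounded compact_continuous_image) auto
  then obtain C where C: "\<forall>y\<in>f ` {a..b}. cmod y \<le> C" unfolding bounded_iff by blast
  show thesis
  proof
    show "0 < a" by fact
    show "cmod (f t) \<le> C * indicator {a..b} t" if "t > 0" for t
    proof (cases "t \<in> {a..b}")
      case True
      then show ?thesis using C by simp
    next
      case False
      then show ?thesis using F(2)[OF that] by auto
    qed
  qed
qed

section \<open>Approximation of functions that vanish near the origin\<close>

lemma class_M_exp: "\<mu> \<in> class_M \<Longrightarrow> t > 0 \<Longrightarrow> set_integrable \<mu> {0<..} (\<lambda>x. exp (- t * x))"
  by (simp add: class_M_def)

text \<open>
  Away from the origin of the time axis the kernel is at most \<open>exp (- a * x)\<close>. Integrability, as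
  opposed to square integrability, removes the singularity at \<open>x = 0\<close>.
\<close>

lemma laplace_bound_tame:
  assumes f: "f \<in> borel_measurable lebesgue_pos" and g: "integrable lebesgue_pos g"
    and le: "AE t in lebesgue_pos. cmod (f t) \<le> g t" and zero: "\<And>t. t \<le> a \<Longrightarrow> g t = 0"
    and x: "x > 0" and a: "a > 0"
  shows "cmod (laplace f x) \<le> exp (- a * x) * (\<integral>t. g t \<partial>lebesgue_pos)"
proof -
  have k: "(\<lambda>t. exp (- t * x)) \<in> borel_measurable lebesgue_pos"
    by (rule borel_measurable_lebesgue_pos) measurable
  have b: "AE t in lebesgue_pos. cmod (complex_of_real (exp (- t * x)) * f t) \<le> exp (- a * x) * g t"
    using le
  proof eventually_elim
    case (elim t)
    show ?case
    proof (cases "t \<le> a")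
      case True
      then show ?thesis using elim zero by simp
    next
      case False
      then show ?thesis using elim x by (auto simp: norm_mult intro!: mult_mono)
    qed
  qed
  have "cmod (laplace f x) \<le> (\<integral>t. cmod (complex_of_real (exp (- t * x)) * f t) \<partial>lebesgue_pos)"
    unfolding laplace_def by (rule integral_norm_bound)
  also have "\<dots> \<le> (\<integral>t. exp (- a * x) * g t \<partial>lebesgue_pos)"
  proof (rule integral_mono_AE[OF _ _ b])
    show int: "integrable lebesgue_pos (\<lambda>t. exp (- a * x) * g t)" using g by simp
    show "integrable lebesgue_pos (\<lambda>t. cmod (complex_of_real (exp (- t * x)) * f t))"
      by (rule Bochner_Integration.integrable_bound[OF int])
         (use b f k in \<open>auto intro!: borel_measurable_times borel_measurable_norm elim!: AE_mp\<close>)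
  qed
  finally show ?thesis by simp
qed

text \<open>
  For functions with a common majorant that is integrable, square integrable and zero on \<open>{..a}\<close>, the
  form norm is as harmless as the $L^2$ norm: the transforms have the majorant
  \<open>K * exp (- a * x)\<close>, which is square integrable by the definition of \<open>class_M\<close>.
\<close>

lemma energy_tendsto_tame:
  assumes \<mu>: "\<mu> \<in> class_M" and s: "\<And>n. s n \<in> borel_measurable lebesgue_pos" and f: "f \<in> borel_measurable lebesgue_pos"
    and lim: "AE t in lebesgue_pos. (\<lambda>n. s n t) \<longlonglongrightarrow> f t"
    and le: "\<And>n. AE t in lebesgue_pos. cmod (s n t) \<le> g t"
    and g: "integrable lebesgue_pos g" "integrable lebesgue_pos (\<lambda>t. (g t)\<^sup>2)"
    and a: "a > 0" "\<And>t. t \<le> a \<Longrightarrow> g t = 0"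
  shows "f \<in> Dom_Q \<mu>" "\<And>n. s n \<in> Dom_Q \<mu>" "(\<lambda>n. energy \<mu> (\<lambda>t. s n t - f t)) \<longlonglongrightarrow> 0"
proof -
  note D = square_integrable_dominated[OF f s lim le g(2)]
  have G: "set_integrable \<mu> {0<..} (\<lambda>x. (exp (- a * x) * (\<integral>t. g t \<partial>lebesgue_pos))\<^sup>2)"
  proof -
    have "set_integrable \<mu> {0<..} (\<lambda>x. exp (- (2 * a) * x) * (\<integral>t. g t \<partial>lebesgue_pos)\<^sup>2)"
      using class_M_exp[OF \<mu>, of "2 * a"] a(1) by (intro set_integrable_mult_left) auto
    moreover have "(exp (- a * x) * (\<integral>t. g t \<partial>lebesgue_pos))\<^sup>2 = exp (- (2 * a) * x) * (\<integral>t. g t \<partial>lebesgue_pos)\<^sup>2" for x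
      by (simp add: power_mult_distrib mult.assoc flip: exp_double)
    ultimately show ?thesis by simp
  qed
  note E = energy_tendsto_dominated[OF \<mu> D(2) D(1) D(3) laplace_bound_tame[OF s g(1) le a(2) _ a(1)] G]
  show "f \<in> Dom_Q \<mu>" "s n \<in> Dom_Q \<mu>" "(\<lambda>n. energy \<mu> (\<lambda>t. s n t - f t)) \<longlonglongrightarrow> 0" for n
    using E by simp_all
qed

lemma integrable_indicator_lebesgue_pos:
  "integrable lebesgue_pos (\<lambda>t. C * indicator {a..b} t :: real)"
  "integrable lebesgue_pos (\<lambda>t. (C * indicator {a..b} t)\<^sup>2 :: real)"
proof -
  have "integrable lebesgue (\<lambda>t. indicator {0<..} t *\<^sub>R (indicator {a..b} t :: real))"
  proof -
    have "integrable lebesgue (indicator ({0<..} \<inter> {a..b}) :: real \<Rightarrow> real)"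
    proof (rule integrable_real_indicator)
      have "emeasure lebesgue ({0<..} \<inter> {a..b}) \<le> emeasure lebesgue {a..b}" by (intro emeasure_mono) auto
      also have "\<dots> < \<infinity>" by (cases "a \<le> b") auto
      finally show "emeasure lebesgue ({0<..} \<inter> {a..b}) < \<infinity>" .
    qed auto
    moreover have "(\<lambda>t. indicator {0<..} t *\<^sub>R (indicator {a..b} t :: real)) = indicator ({0<..} \<inter> {a..b})"
      by (auto simp: indicator_def fun_eq_iff)
    ultimately show ?thesis by simp
  qed
  then have *: "integrable lebesgue_pos (indicator {a..b} :: real \<Rightarrow> real)"
    by (simp add: integrable_restrict_space)
  then show "integrable lebesgue_pos (\<lambda>t. C * indicator {a..b} t :: real)" by simp
  have "(\<lambda>t. (C * indicator {a..b} t)\<^sup>2 :: real) = (\<lambda>t. C\<^sup>2 * indicator {a..b} t)" by (auto simp: indicator_def)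
  then show "integrable lebesgue_pos (\<lambda>t. (C * indicator {a..b} t)\<^sup>2 :: real)" using * by simp
qed

lemma Cinf_comp_subset_Dom_Q:
  assumes \<mu>: "\<mu> \<in> class_M"
  shows "Cinf_comp \<subseteq> Dom_Q \<mu>"
proof
  fix f assume f: "f \<in> Cinf_comp"
  obtain a b C where a: "0 < a" and le: "\<And>t. t > 0 \<Longrightarrow> cmod (f t) \<le> C * indicator {a..b} t"
    using Cinf_comp_bound[OF f] by metis
  have zero: "C * indicator {a..b} t = 0" if "t \<le> a / 2" for t
    using that a by (auto simp: indicator_def)
  have ae: "AE t in lebesgue_pos. cmod (f t) \<le> C * indicator {a..b} t"
    by (rule AE_I2) (use le in auto)
  have m: "f \<in> borel_measurable lebesgue_pos"
    by (rule continuous_imp_measurable_on_sets_lebesgue[OF Cinf_comp_continuous_on[OF f]]) simp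
  show "f \<in> Dom_Q \<mu>"
    by (rule energy_tendsto_tame(1)[where a = "a / 2", OF \<mu> m m _ ae integrable_indicator_lebesgue_pos _ zero])
       (use a in simp_all)
qed

text \<open>
  Membership in the closure of the test functions with respect to the form norm.
\<close>

definition approximable :: "real measure \<Rightarrow> (real \<Rightarrow> complex) \<Rightarrow> bool" where
  "approximable \<mu> f \<longleftrightarrow> f \<in> Dom_Q \<mu> \<and> (\<forall>e>0. \<exists>h\<in>Cinf_comp. energy \<mu> (\<lambda>t. f t - h t) < e)"

lemma approximable_Cinf_comp:
  assumes "\<mu> \<in> class_M" "f \<in> Cinf_comp"
  shows "approximable \<mu> f"
proof -
  have "energy \<mu> (\<lambda>t. f t - f t) = 0" using energy_cmult[of \<mu> 0 f] by simp
  then have "\<exists>h\<in>Cinf_comp. energy \<mu> (\<lambda>t. f t - h t) < e" if "e > 0" for e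
    using that by (intro bexI[OF _ assms(2)]) simp
  then show ?thesis using assms Cinf_comp_subset_Dom_Q[OF assms(1)] by (auto simp: approximable_def)
qed

lemma approximable_limit:
  assumes \<mu>: "\<mu> \<in> class_M" and s: "\<And>n. approximable \<mu> (s n)" and f: "f \<in> Dom_Q \<mu>"
    and lim: "(\<lambda>n. energy \<mu> (\<lambda>t. s n t - f t)) \<longlonglongrightarrow> 0"
  shows "approximable \<mu> f"
  unfolding approximable_def
proof (intro conjI allI impI f)
  fix e :: real assume e: "e > 0"
  then have "\<forall>\<^sub>F n in sequentially. energy \<mu> (\<lambda>t. s n t - f t) < e / 4"
    by (intro order_tendstoD(2)[OF lim]) auto
  then obtain n where n: "energy \<mu> (\<lambda>t. s n t - f t) < e / 4"
    by (auto simp: eventually_sequentially)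
  obtain h where h: "h \<in> Cinf_comp" "energy \<mu> (\<lambda>t. s n t - h t) < e / 4"
    using s[of n] divide_pos_pos[OF e, of 4] unfolding approximable_def by fastforce
  have sn: "s n \<in> Dom_Q \<mu>" "h \<in> Dom_Q \<mu>"
    using s[of n] h(1) Cinf_comp_subset_Dom_Q[OF \<mu>] by (auto simp: approximable_def)
  have "energy \<mu> (\<lambda>t. (s n t - h t) + (- 1) * (s n t - f t))
      \<le> 2 * energy \<mu> (\<lambda>t. s n t - h t) + 2 * energy \<mu> (\<lambda>t. (- 1) * (s n t - f t))"
    by (intro energy_add_le \<mu> Dom_Q_cmult Dom_Q_diff sn f)
  also have "\<dots> = 2 * energy \<mu> (\<lambda>t. s n t - h t) + 2 * energy \<mu> (\<lambda>t. s n t - f t)"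
    by (subst energy_cmult) simp
  also have "\<dots> < e" using n h(2) by simp
  finally have "energy \<mu> (\<lambda>t. f t - h t) < e" by simp
  then show "\<exists>h\<in>Cinf_comp. energy \<mu> (\<lambda>t. f t - h t) < e" using h(1) by blast
qed

lemma approximable_add:
  assumes \<mu>: "\<mu> \<in> class_M" and f: "approximable \<mu> f" and g: "approximable \<mu> g"
  shows "approximable \<mu> (\<lambda>t. f t + g t)"
  unfolding approximable_def
proof (intro conjI allI impI)
  have D: "f \<in> Dom_Q \<mu>" "g \<in> Dom_Q \<mu>" using f g by (auto simp: approximable_def)
  then show "(\<lambda>t. f t + g t) \<in> Dom_Q \<mu>" by (intro Dom_Q_add \<mu>)
  fix e :: real assume e: "e > 0"
  obtain h where h: "h \<in> Cinf_comp" "energy \<mu> (\<lambda>t. f t - h t) < e / 4"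
    using f divide_pos_pos[OF e, of 4] unfolding approximable_def by fastforce
  obtain k where k: "k \<in> Cinf_comp" "energy \<mu> (\<lambda>t. g t - k t) < e / 4"
    using g divide_pos_pos[OF e, of 4] unfolding approximable_def by fastforce
  have "energy \<mu> (\<lambda>t. (f t - h t) + (g t - k t)) \<le> 2 * energy \<mu> (\<lambda>t. f t - h t) + 2 * energy \<mu> (\<lambda>t. g t - k t)"
    using h(1) k(1) Cinf_comp_subset_Dom_Q[OF \<mu>] by (intro energy_add_le \<mu> Dom_Q_diff D) auto
  also have "\<dots> < e" using h(2) k(2) by simp
  finally have "energy \<mu> (\<lambda>t. (f t + g t) - (h t + k t)) < e" by (simp add: add_diff_add)
  then show "\<exists>h\<in>Cinf_comp. energy \<mu> (\<lambda>t. (f t + g t) - h t) < e"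
    by (rule bexI[OF _ Cinf_comp_add[OF h(1) k(1)]])
qed

lemma approximable_cmult:
  assumes \<mu>: "\<mu> \<in> class_M" and f: "approximable \<mu> f"
  shows "approximable \<mu> (\<lambda>t. c * f t)"
  unfolding approximable_def
proof (intro conjI allI impI)
  show "(\<lambda>t. c * f t) \<in> Dom_Q \<mu>" using f by (intro Dom_Q_cmult \<mu>) (simp add: approximable_def)
  fix e :: real assume e: "e > 0"
  have c: "(cmod c)\<^sup>2 + 1 > 0" by (simp add: add_nonneg_pos)
  then have "e / ((cmod c)\<^sup>2 + 1) > 0" using e by simp
  then obtain h where h: "h \<in> Cinf_comp" "energy \<mu> (\<lambda>t. f t - h t) < e / ((cmod c)\<^sup>2 + 1)"
    using f unfolding approximable_def by blast
  have "energy \<mu> (\<lambda>t. c * (f t - h t)) = (cmod c)\<^sup>2 * energy \<mu> (\<lambda>t. f t - h t)" by (rule energy_cmult)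
  also have "\<dots> \<le> ((cmod c)\<^sup>2 + 1) * energy \<mu> (\<lambda>t. f t - h t)"
    using energy_nonneg by (intro mult_right_mono) auto
  also have "\<dots> < e" using h(2) c by (simp add: field_simps)
  finally show "\<exists>h\<in>Cinf_comp. energy \<mu> (\<lambda>t. c * f t - h t) < e"
    using Cinf_comp_cmult[OF h(1), of c] by (auto simp: right_diff_distrib)
qed

lemma approximable_sum:
  assumes \<mu>: "\<mu> \<in> class_M" and f: "\<And>i. i \<in> I \<Longrightarrow> approximable \<mu> (f i)" and "finite I"
  shows "approximable \<mu> (\<lambda>t. \<Sum>i\<in>I. f i t)"
  using assms(3) f
proof (induction I rule: finite_induct)
  case empty
  then show ?case using approximable_Cinf_comp[OF \<mu> zero_in_Cinf_comp] by simp
next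
  case (insert i I)
  have "approximable \<mu> (\<lambda>t. f i t + (\<Sum>i\<in>I. f i t))" using insert by (intro approximable_add \<mu>) auto
  then show ?case using insert by simp
qed

lemma approximable_tame_limit:
  assumes \<mu>: "\<mu> \<in> class_M" and s: "\<And>n. approximable \<mu> (s n)" and f: "f \<in> borel_measurable borel"
    and lim: "\<And>t. t > 0 \<Longrightarrow> (\<lambda>n. s n t) \<longlonglongrightarrow> f t"
    and le: "\<And>n t. t > 0 \<Longrightarrow> cmod (s n t) \<le> g t"
    and g: "integrable lebesgue_pos g" "integrable lebesgue_pos (\<lambda>t. (g t)\<^sup>2)"
    and a: "a > 0" "\<And>t. t \<le> a \<Longrightarrow> g t = 0"
  shows "approximable \<mu> f"
proof -
  have m: "s n \<in> borel_measurable lebesgue_pos" for n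
    using s[of n] \<mu> by (simp add: approximable_def Dom_Q_iff square_integrable_def)
  have lim': "AE t in lebesgue_pos. (\<lambda>n. s n t) \<longlonglongrightarrow> f t" by (rule AE_I2) (use lim in auto)
  have le': "AE t in lebesgue_pos. cmod (s n t) \<le> g t" for n by (rule AE_I2) (use le in auto)
  note E = energy_tendsto_tame[OF \<mu> m borel_measurable_lebesgue_pos[OF f] lim' le' g a]
  show ?thesis by (rule approximable_limit[OF \<mu> s E(1,3)])
qed

lemma approximable_interval:
  assumes \<mu>: "\<mu> \<in> class_M" and a: "a > 0"
  shows "approximable \<mu> (indicator {a<..<b})"
proof (rule approximable_tame_limit[OF \<mu>])
  show "approximable \<mu> (bump (1 / Suc n) a b)" for n
    using a by (intro approximable_Cinf_comp \<mu> bump_in_Cinf_comp) auto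
  show "(\<lambda>n. bump (1 / Suc n) a b t) \<longlonglongrightarrow> indicator {a<..<b} t" for t
  proof (cases "t \<in> {a<..<b}")
    case True
    have "(\<lambda>n. - (1 / real (Suc n)) / ((t - a) * (b - t))) \<longlonglongrightarrow> - 0 / ((t - a) * (b - t))"
      using True by (intro tendsto_intros LIMSEQ_Suc[OF lim_1_over_n]) auto
    then have "(\<lambda>n. complex_of_real (exp (- (1 / real (Suc n)) / ((t - a) * (b - t))))) \<longlonglongrightarrow> complex_of_real (exp 0)"
      by (intro tendsto_of_real tendsto_exp) simp
    then show ?thesis using True by (simp add: bump_def)
  next
    case False
    then have "bump (1 / Suc n) a b t = 0" for n by (auto simp: bump_def)
    then show ?thesis using False by simp
  qed
  show "cmod (bump (1 / Suc n) a b t) \<le> indicator {a..b} t" for n t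
    by (auto simp: bump_def indicator_def)
  show "indicator {a..b} t = (0 :: real)" if "t \<le> a / 2" for t
    using that a by (auto simp: indicator_def)
qed (use a integrable_indicator_lebesgue_pos[of 1 a b] in simp_all)

text \<open>
  The Borel sets with this property form a Dynkin system: differences are linear combinations, and
  disjoint unions are dominated limits of finite sums. It contains the half-lines by
  \<open>approximable_interval\<close>.
\<close>

lemma approximable_borel_set:
  assumes \<mu>: "\<mu> \<in> class_M" and a: "a > 0" and A: "A \<in> sets borel"
  shows "approximable \<mu> (indicator (A \<inter> {a<..<b}))"
proof -
  have sets: "sets (borel :: real measure) = sigma_sets UNIV (range lessThan)"
    by (subst borel_Iio) simp
  have Int: "Int_stable (range (lessThan :: real \<Rightarrow> real set))"
    unfolding Int_stable_def
  proof (intro ballI)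
    fix A B :: "real set" assume "A \<in> range lessThan" "B \<in> range lessThan"
    then obtain s t where "A = {..<s}" "B = {..<t}" by auto
    then have "A \<inter> B = {..<min s t}" by auto
    then show "A \<inter> B \<in> range lessThan" by simp
  qed
  have sub: "range lessThan \<subseteq> Pow (UNIV :: real set)" by simp
  have gen: "A \<in> sigma_sets UNIV (range lessThan)" using A sets by simp
  show ?thesis
    using Int sub gen
  proof (induction A rule: sigma_sets_induct_disjoint)
    case (basic A)
    then obtain s where "A = {..<s}" by auto
    then have "A \<inter> {a<..<b} = {a<..<min s b}" by auto
    then show ?case using approximable_interval[OF \<mu> a] by simp
  next
    case empty
    then show ?case using approximable_Cinf_comp[OF \<mu> zero_in_Cinf_comp] by simp
  next
    case (compl A)
    have "approximable \<mu> (\<lambda>t. indicator {a<..<b} t + (- 1) * indicator (A \<inter> {a<..<b}) t)"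
      by (intro approximable_add approximable_cmult \<mu> approximable_interval a compl)
    moreover have "(\<lambda>t. indicator {a<..<b} t + (- 1) * indicator (A \<inter> {a<..<b}) t :: complex)
        = indicator ((UNIV - A) \<inter> {a<..<b})"
      by (auto simp: indicator_def)
    ultimately show ?case by simp
  next
    case (union A)
    have sum: "(\<Sum>i<n. indicator (A i \<inter> {a<..<b}) t) = (indicator (\<Union>i<n. A i \<inter> {a<..<b}) t :: complex)" for n t
    proof (rule indicator_UN_disjoint[symmetric])
      show "disjoint_family_on (\<lambda>i. A i \<inter> {a<..<b}) {..<n}"
        using union(1) by (auto simp: disjoint_family_on_def)
    qed simp
    have "approximable \<mu> (indicator (\<Union>i. A i \<inter> {a<..<b}))"
    proof (rule approximable_tame_limit[OF \<mu>])
      show "approximable \<mu> (\<lambda>t. \<Sum>i<n. indicator (A i \<inter> {a<..<b}) t)" for n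
        by (intro approximable_sum \<mu> union) auto
      have "A i \<in> sets borel" for i using union(2) sets by auto
      then show "(indicator (\<Union>i. A i \<inter> {a<..<b}) :: real \<Rightarrow> complex) \<in> borel_measurable borel"
        by (intro borel_measurable_indicator) auto
      show "(\<lambda>n. \<Sum>i<n. indicator (A i \<inter> {a<..<b}) t) \<longlonglongrightarrow> (indicator (\<Union>i. A i \<inter> {a<..<b}) t :: complex)" for t
        unfolding sum by (rule LIMSEQ_indicator_UN)
      show "cmod (\<Sum>i<n. indicator (A i \<inter> {a<..<b}) t) \<le> indicator {a..b} t" for n t
        unfolding sum by (auto simp: indicator_def)
      show "indicator {a..b} t = (0 :: real)" if "t \<le> a / 2" for t
        using that a by (auto simp: indicator_def)
    qed (use a integrable_indicator_lebesgue_pos[of 1 a b] in simp_all)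
    then show ?case by (simp only: UN_simps)
  qed
qed

text \<open>
  A pointwise approximation of \<open>f\<close> by simple functions, cut off at time \<open>n\<close>, is dominated by \<open>2 \<bar>f\<bar>\<close>.
\<close>

lemma approximable_tame:
  assumes \<mu>: "\<mu> \<in> class_M" and f: "f \<in> borel_measurable borel"
    and int: "integrable lebesgue_pos f" "integrable lebesgue_pos (\<lambda>t. (cmod (f t))\<^sup>2)"
    and a: "a > 0" "\<And>t. t \<le> a \<Longrightarrow> f t = 0"
  shows "approximable \<mu> f"
proof -
  obtain F where F: "\<And>i. simple_function borel (F i)" "\<And>t. (\<lambda>i. F i t) \<longlonglongrightarrow> f t"
    "\<And>i t. cmod (F i t) \<le> 2 * cmod (f t)"
    using borel_measurable_implies_sequence_metric[OF f, of 0] by auto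
  show ?thesis
  proof (rule approximable_tame_limit[OF \<mu> _ f])
    show "approximable \<mu> (\<lambda>t. F n t * indicator {a<..<real n} t)" for n
    proof -
      have "approximable \<mu> (\<lambda>t. \<Sum>y\<in>range (F n). y * indicator ((F n -` {y}) \<inter> {a<..<real n}) t)"
      proof (intro approximable_sum approximable_cmult approximable_borel_set \<mu> a(1))
        show "F n -` {y} \<in> sets borel" for y using simple_functionD(2)[OF F(1)[of n]] by simp
        show "finite (range (F n))" using simple_functionD(1)[OF F(1)[of n]] by simp
      qed
      moreover have "(\<Sum>y\<in>range (F n). y * indicator ((F n -` {y}) \<inter> {a<..<real n}) t) = F n t * indicator {a<..<real n} t" for t
      proof -
        have "finite (range (F n))" using simple_functionD(1)[OF F(1)[of n]] by simp
        moreover have "(\<Sum>y\<in>range (F n). y * indicator ((F n -` {y}) \<inter> {a<..<real n}) t)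
            = (\<Sum>y\<in>range (F n). if y = F n t then F n t * indicator {a<..<real n} t else 0)"
          by (intro sum.cong) (auto simp: indicator_def)
        ultimately show ?thesis by simp
      qed
      ultimately show ?thesis by simp
    qed
    show "(\<lambda>n. F n t * indicator {a<..<real n} t) \<longlonglongrightarrow> f t" for t
    proof (cases "t \<le> a")
      case True
      then show ?thesis using a by simp
    next
      case False
      obtain N :: nat where N: "t < real N" using reals_Archimedean2 by blast
      have "\<forall>\<^sub>F n in sequentially. F n t = F n t * indicator {a<..<real n} t"
        using eventually_ge_at_top[of N] by eventually_elim (use False N in auto)
      then show ?thesis by (rule Lim_transform_eventually[OF F(2)])
    qed
    show "cmod (F n t * indicator {a<..<real n} t) \<le> 2 * cmod (f t)" for n t
      using F(3)[where i=n and t=t] order_trans[OF norm_ge_zero F(3)[where i=n and t=t]] by (auto simp: indicator_def)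
    show "integrable lebesgue_pos (\<lambda>t. 2 * cmod (f t))" using int(1) by simp
    show "integrable lebesgue_pos (\<lambda>t. (2 * cmod (f t))\<^sup>2)" using int(2) by (simp add: power_mult_distrib)
    show "2 * cmod (f t) = 0" if "t \<le> a" for t using a(2)[OF that] by simp
  qed (fact a(1))
qed

section \<open>Translations\<close>

text \<open>
  Passing to the whole line, with Borel functions that vanish on \<open>{..0}\<close>, makes the translation
  invariance of Lebesgue measure available.
\<close>

lemma lebesgue_pos_eq_lborel:
  fixes h :: "real \<Rightarrow> 'a::{banach, second_countable_topology}"
  assumes "h \<in> borel_measurable borel" "\<And>t. t \<le> 0 \<Longrightarrow> h t = 0"
  shows "integrable lebesgue_pos h \<longleftrightarrow> integrable lborel h"
    and "integral\<^sup>L lebesgue_pos h = integral\<^sup>L lborel h"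
proof -
  have "(\<lambda>t. indicator {0<..} t *\<^sub>R h t) = h" using assms(2) by (auto simp: indicator_def fun_eq_iff not_less)
  then show "integrable lebesgue_pos h \<longleftrightarrow> integrable lborel h" "integral\<^sup>L lebesgue_pos h = integral\<^sup>L lborel h"
    using assms(1) by (simp_all add: integrable_restrict_space integral_restrict_space integrable_completion integral_completion)
qed

text \<open>
  Borel representatives of elements of \<open>L2_pos\<close>, extended by zero. Right translations preserve this
  class.
\<close>

definition causal :: "(real \<Rightarrow> complex) \<Rightarrow> bool" where
  "causal f \<longleftrightarrow> f \<in> borel_measurable borel \<and> (\<forall>t\<le>0. f t = 0) \<and> integrable lborel (\<lambda>t. (cmod (f t))\<^sup>2)"

lemma causal_square_integrable:
  assumes "f \<in> borel_measurable borel" "\<And>t. t \<le> 0 \<Longrightarrow> f t = 0"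
  shows "square_integrable lebesgue_pos f \<longleftrightarrow> causal f"
    and "(\<integral>t. (cmod (f t))\<^sup>2 \<partial>lebesgue_pos) = (\<integral>t. (cmod (f t))\<^sup>2 \<partial>lborel)"
proof -
  have m: "(\<lambda>t. (cmod (f t))\<^sup>2) \<in> borel_measurable borel" and z: "\<And>t. t \<le> 0 \<Longrightarrow> (cmod (f t))\<^sup>2 = 0"
    using assms by auto
  show "(\<integral>t. (cmod (f t))\<^sup>2 \<partial>lebesgue_pos) = (\<integral>t. (cmod (f t))\<^sup>2 \<partial>lborel)"
    by (rule lebesgue_pos_eq_lborel(2)[OF m z])
  show "square_integrable lebesgue_pos f \<longleftrightarrow> causal f"
    using lebesgue_pos_eq_lborel(1)[OF m z] assms borel_measurable_lebesgue_pos[OF assms(1)]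
    by (auto simp: square_integrable_def causal_def)
qed

lemma causalD:
  assumes "causal f"
  shows "f \<in> borel_measurable borel" "t \<le> 0 \<Longrightarrow> f t = 0" "square_integrable lebesgue_pos f"
    "square_integrable lborel f"
    "(\<integral>t. (cmod (f t))\<^sup>2 \<partial>lebesgue_pos) = (\<integral>t. (cmod (f t))\<^sup>2 \<partial>lborel)"
  using assms causal_square_integrable[of f] by (auto simp: causal_def square_integrable_def)

lemma causalI:
  assumes "square_integrable lborel f" "\<And>t. t \<le> 0 \<Longrightarrow> f t = 0"
  shows "causal f"
  using assms by (simp add: causal_def square_integrable_def)

text \<open>
  A delay by \<open>s\<close> multiplies the transform by \<open>exp (- s * x)\<close>, which only makes it smaller.
\<close>

lemma causal_shift:
  assumes f: "causal f" and s: "s \<ge> 0"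
  shows "causal (\<lambda>t. f (t - s))"
    and "(\<integral>t. (cmod (f (t - s)))\<^sup>2 \<partial>lborel) = (\<integral>t. (cmod (f t))\<^sup>2 \<partial>lborel)"
    and "laplace (\<lambda>t. f (t - s)) x = complex_of_real (exp (- s * x)) * laplace f x"
proof -
  note [measurable] = causalD(1)[OF f]
  have int: "integrable lborel (\<lambda>t. (cmod (f t))\<^sup>2)" using f by (simp add: causal_def)
  show c: "causal (\<lambda>t. f (t - s))"
    unfolding causal_def
  proof (intro conjI allI impI)
    show "f (t - s) = 0" if "t \<le> 0" for t using that s causalD(2)[OF f] by simp
    show "integrable lborel (\<lambda>t. (cmod (f (t - s)))\<^sup>2)"
      using lborel_integrable_real_affine[OF int, of 1 "- s"] by (simp add: add.commute)
  qed measurable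
  show "(\<integral>t. (cmod (f (t - s)))\<^sup>2 \<partial>lborel) = (\<integral>t. (cmod (f t))\<^sup>2 \<partial>lborel)"
    using lborel_integral_real_affine[of 1 "\<lambda>t. (cmod (f t))\<^sup>2" "- s"] by (simp add: add.commute)
  have L: "laplace g x = (\<integral>t. complex_of_real (exp (- t * x)) * g t \<partial>lborel)" if "causal g" for g
    unfolding laplace_def
  proof (rule lebesgue_pos_eq_lborel(2))
    note [measurable] = causalD(1)[OF that]
    show "(\<lambda>t. complex_of_real (exp (- t * x)) * g t) \<in> borel_measurable borel" by measurable
  qed (use causalD(2)[OF that] in simp)
  have "laplace (\<lambda>t. f (t - s)) x = (\<integral>t. complex_of_real (exp (- (s + 1 * t) * x)) * f ((s + 1 * t) - s) \<partial>lborel)"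
    unfolding L[OF c] using lborel_integral_real_affine[of 1 "\<lambda>t. complex_of_real (exp (- t * x)) * f (t - s)" s]
    by simp
  also have "\<dots> = (\<integral>t. complex_of_real (exp (- s * x)) * (complex_of_real (exp (- t * x)) * f t) \<partial>lborel)"
    by (simp add: distrib_right exp_add exp_diff exp_minus field_simps)
  also have "\<dots> = complex_of_real (exp (- s * x)) * laplace f x"
    unfolding L[OF f] by simp
  finally show "laplace (\<lambda>t. f (t - s)) x = complex_of_real (exp (- s * x)) * laplace f x" .
qed

text \<open>
  For the null measure the form vanishes, so density in the form norm becomes density in $L^2$.
\<close>

lemma null_measure_class_M: "null_measure borel \<in> class_M"
proof -
  have "set_integrable (null_measure borel) {0<..} (\<lambda>x. exp (- t * x))" for t :: real
    unfolding set_integrable_def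
    by (rule integrableI_bounded) (auto simp: nn_integral_null_measure)
  then show ?thesis by (auto simp: class_M_def measure_support_def)
qed

text \<open>
  Integrable functions in $L^2$ that vanish near the origin are already known to be approximable, for
  every measure of the class. For the null measure the cut-offs \<open>f * indicator {1 / (n + 1)<..n}\<close> converge to \<open>f\<close> as well.
\<close>

lemma Cinf_comp_dense_L2:
  assumes f: "causal f" and e: "e > 0"
  obtains h where "h \<in> Cinf_comp" "(\<integral>t. (cmod (f t - h t))\<^sup>2 \<partial>lebesgue_pos) < e"
proof -
  let ?N = "null_measure borel :: real measure"
  note \<mu> = null_measure_class_M
  have E: "energy ?N h = (\<integral>t. (cmod (h t))\<^sup>2 \<partial>lebesgue_pos)" for h
    by (simp add: energy_def integral_null_measure)
  note [measurable] = causalD(1)[OF f]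
  define s where "s n t = f t * indicator {1 / real (Suc n)<..real n} t" for n t
  have s_m: "s n \<in> borel_measurable borel" for n unfolding s_def by measurable
  have s_le: "cmod (s n t) \<le> cmod (f t)" for n t by (auto simp: s_def indicator_def)
  have s_lim: "(\<lambda>n. s n t) \<longlonglongrightarrow> f t" for t
  proof (cases "t \<le> 0")
    case True
    then show ?thesis using causalD(2)[OF f True] by (simp add: s_def)
  next
    case False
    obtain N :: nat where N: "t < real N" using reals_Archimedean2 by blast
    have "(\<lambda>n. 1 / real (Suc n)) \<longlonglongrightarrow> 0" by (rule LIMSEQ_Suc[OF lim_1_over_n])
    then have "\<forall>\<^sub>F n in sequentially. 1 / real (Suc n) < t"
      using False by (intro order_tendstoD(2)) auto
    then have "\<forall>\<^sub>F n in sequentially. f t = s n t"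
      using eventually_ge_at_top[of N] by eventually_elim (use N in \<open>auto simp: s_def\<close>)
    then show ?thesis by (rule Lim_transform_eventually[OF tendsto_const])
  qed
  have G: "integrable lebesgue_pos (\<lambda>t. (cmod (f t))\<^sup>2)" using causalD(3)[OF f] by (simp add: square_integrable_def)
  have L2: "square_integrable lebesgue_pos (s n)" "(\<lambda>n. \<integral>t. (cmod (s n t - f t))\<^sup>2 \<partial>lebesgue_pos) \<longlonglongrightarrow> 0" for n
    by (rule square_integrable_dominated[OF borel_measurable_lebesgue_pos[OF causalD(1)[OF f]]
        borel_measurable_lebesgue_pos[OF s_m] _ _ G]; use s_lim s_le in simp)+
  have app: "approximable ?N (s n)" for n
  proof (rule approximable_tame[OF \<mu> s_m])
    show "integrable lebesgue_pos (\<lambda>t. (cmod (s n t))\<^sup>2)" using L2(1) by (simp add: square_integrable_def)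
    have "integrable lebesgue_pos (\<lambda>t. indicator {0..real n} t + (cmod (f t))\<^sup>2)"
      using integrable_indicator_lebesgue_pos(1)[of 1 0 "real n"] G by simp
    then show "integrable lebesgue_pos (s n)"
    proof (rule Bochner_Integration.integrable_bound)
      have "cmod (s n t) \<le> indicator {0..real n} t + (cmod (f t))\<^sup>2" for t
      proof (cases "t \<in> {1 / real (Suc n)<..real n}")
        case True
        have "0 \<le> 1 / real (Suc n)" by simp
        then have "t \<in> {0..real n}"
          using True unfolding atLeastAtMost_iff greaterThanAtMost_iff by linarith
        moreover have "2 * cmod (f t) \<le> (cmod (f t))\<^sup>2 + 1"
          using sum_squares_bound[of "cmod (f t)" 1] by simp
        then have "cmod (f t) \<le> 1 + (cmod (f t))\<^sup>2"
          using norm_ge_zero[of "f t"] by linarith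
        ultimately show ?thesis using True by (simp add: s_def)
      qed (simp add: s_def)
      then show "AE t in lebesgue_pos. norm (s n t) \<le> norm (indicator {0..real n} t + (cmod (f t))\<^sup>2)"
        by (intro AE_I2) (simp add: order_trans[OF _ abs_ge_self])
    qed (rule borel_measurable_lebesgue_pos[OF s_m])
    show "s n t = 0" if "t \<le> 1 / real (Suc n)" for t using that by (auto simp: s_def)
  qed simp
  have D: "f \<in> Dom_Q ?N"
    using causalD(3)[OF f] laplace_pos_measurable[OF \<mu>]
    by (auto simp: Dom_Q_iff[OF \<mu>] square_integrable_def intro!: integrableI_bounded simp: nn_integral_null_measure)
  have "approximable ?N f"
    by (rule approximable_limit[where s = s, OF \<mu> app D]) (simp add: E L2(2))
  then show thesis using that e by (auto simp: approximable_def E)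
qed

lemma translation_continuous_Cinf_comp:
  assumes h: "h \<in> Cinf_comp"
  defines "k \<equiv> (\<lambda>t. indicator {0<..} t *\<^sub>R h t)"
  shows "causal k" "(\<lambda>n. \<integral>t. (cmod (k (t - 1 / real (Suc n)) - k t))\<^sup>2 \<partial>lborel) \<longlonglongrightarrow> 0"
proof -
  obtain a b C where a: "0 < a" and le: "\<And>t. t > 0 \<Longrightarrow> cmod (h t) \<le> C * indicator {a..b} t"
    using Cinf_comp_bound[OF h] by metis
  have k_m [measurable]: "k \<in> borel_measurable borel"
    unfolding k_def by (intro borel_measurable_continuous_on_indicator Cinf_comp_continuous_on h) simp
  have k_le: "cmod (k t) \<le> \<bar>C\<bar> * indicator {a..b} t" for t
    using le[of t] by (auto simp: k_def indicator_def split: if_splits)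
  have k0: "k t = 0" if "t < a" for t using k_le[of t] that by simp
  have cont: "isCont k t" for t
  proof (cases "t < a")
    case True
    have "isCont (\<lambda>t. 0 :: complex) t" by simp
    moreover have "\<forall>\<^sub>F u in nhds t. k u = 0"
      using eventually_nhds_in_open[of "{..<a}" t] True by (auto elim!: eventually_mono simp: k0)
    ultimately show ?thesis using isCont_cong[of k "\<lambda>t. 0" t] by blast
  next
    case False
    then have "t \<in> {0<..}" using a by simp
    then have "isCont h t"
      using Cinf_comp_continuous_on[OF h] by (simp add: continuous_on_eq_continuous_at)
    moreover have "\<forall>\<^sub>F u in nhds t. k u = h u"
      using eventually_nhds_in_open[of "{0<..}" t] \<open>t \<in> {0<..}\<close> by (auto elim!: eventually_mono simp: k_def)
    ultimately show ?thesis using isCont_cong[of k h t] by blast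
  qed
  have int: "integrable lborel (\<lambda>t. (\<bar>C\<bar> * indicator {a..b + 1} t)\<^sup>2 :: real)"
  proof -
    have "(\<lambda>t. (\<bar>C\<bar> * indicator {a..b + 1} t)\<^sup>2 :: real) = (\<lambda>t. C\<^sup>2 * indicator {a..b + 1} t)"
      by (auto simp: indicator_def)
    moreover have "integrable lborel (indicator {a..b + 1} :: real \<Rightarrow> real)"
      by (rule integrable_real_indicator) (simp_all add: emeasure_lborel_Icc_eq)
    ultimately show ?thesis by simp
  qed
  have lim: "(\<lambda>n. k (t - 1 / real (Suc n))) \<longlonglongrightarrow> k t" for t
  proof -
    have "(\<lambda>n. t - 1 / real (Suc n)) \<longlonglongrightarrow> t - 0"
      by (intro tendsto_diff tendsto_const LIMSEQ_Suc[OF lim_1_over_n])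
    then show ?thesis using isCont_tendsto_compose[OF cont[of t]] by simp
  qed
  have bd: "cmod (k (t - 1 / real (Suc n))) \<le> \<bar>C\<bar> * indicator {a..b + 1} t" for n t
  proof -
    have "0 \<le> 1 / real (Suc n)" "1 / real (Suc n) \<le> 1" by auto
    then have "t - 1 / real (Suc n) \<in> {a..b} \<Longrightarrow> t \<in> {a..b + 1}"
      unfolding atLeastAtMost_iff by linarith
    then show ?thesis using k_le[of "t - 1 / real (Suc n)"]
      by (cases "t - 1 / real (Suc n) \<in> {a..b}") (auto simp del: of_nat_Suc)
  qed
  have "square_integrable lborel k \<and> (\<lambda>n. \<integral>t. (cmod (k (t - 1 / real (Suc n)) - k t))\<^sup>2 \<partial>lborel) \<longlonglongrightarrow> 0"
    using lim bd by (intro conjI square_integrable_dominated[OF _ _ _ _ int, where s = "\<lambda>n t. k (t - 1 / real (Suc n))"])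
      (simp_all del: of_nat_Suc)
  then show "causal k" "(\<lambda>n. \<integral>t. (cmod (k (t - 1 / real (Suc n)) - k t))\<^sup>2 \<partial>lborel) \<longlonglongrightarrow> 0"
    using k0 a by (auto intro!: causalI)
qed

text \<open>
  The difference \<open>d\<close> of \<open>f\<close> and a test function has small norm, and so have its translates; for
  test functions the claim is \<open>translation_continuous_Cinf_comp\<close>.
\<close>

lemma translation_continuous_L2:
  assumes f: "causal f"
  shows "(\<lambda>n. \<integral>t. (cmod (f (t - 1 / real (Suc n)) - f t))\<^sup>2 \<partial>lborel) \<longlonglongrightarrow> 0"
proof (rule LIMSEQ_I)
  fix e :: real assume e: "e > 0"
  obtain h where h: "h \<in> Cinf_comp" "(\<integral>t. (cmod (f t - h t))\<^sup>2 \<partial>lebesgue_pos) < e / 12"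
    using Cinf_comp_dense_L2[OF f, of "e / 12"] e by auto
  define k where "k = (\<lambda>t. indicator {0<..} t *\<^sub>R h t)"
  have k: "causal k" "(\<lambda>n. \<integral>t. (cmod (k (t - 1 / real (Suc n)) - k t))\<^sup>2 \<partial>lborel) \<longlonglongrightarrow> 0"
    using translation_continuous_Cinf_comp[OF h(1)] by (simp_all add: k_def)
  define d where "d t = f t - k t" for t
  have d: "causal d"
    unfolding d_def[abs_def]
    by (rule causalI) (use square_integrable_diff[OF causalD(4)[OF f] causalD(4)[OF k(1)]] causalD(2)[OF f] causalD(2)[OF k(1)] in auto)
  have "(\<integral>t. (cmod (d t))\<^sup>2 \<partial>lborel) = (\<integral>t. (cmod (f t - h t))\<^sup>2 \<partial>lebesgue_pos)"
    unfolding causalD(5)[OF d, symmetric] by (intro Bochner_Integration.integral_cong) (auto simp: d_def k_def)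
  then have d_small: "(\<integral>t. (cmod (d t))\<^sup>2 \<partial>lborel) < e / 12" using h(2) by simp
  have "\<forall>\<^sub>F n in sequentially. (\<integral>t. (cmod (k (t - 1 / real (Suc n)) - k t))\<^sup>2 \<partial>lborel) < e / 12"
    using e by (intro order_tendstoD(2)[OF k(2)]) simp
  then obtain N where N: "\<And>n. n \<ge> N \<Longrightarrow> (\<integral>t. (cmod (k (t - 1 / real (Suc n)) - k t))\<^sup>2 \<partial>lborel) < e / 12"
    by (auto simp: eventually_sequentially)
  have "(\<integral>t. (cmod (f (t - 1 / real (Suc n)) - f t))\<^sup>2 \<partial>lborel) < e" if "n \<ge> N" for n
  proof -
    let ?s = "1 / real (Suc n)"
    have ds: "square_integrable lborel (\<lambda>t. d (t - ?s))" "square_integrable lborel (\<lambda>t. (- 1) * d t)"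
      "square_integrable lborel (\<lambda>t. k (t - ?s) - k t)"
      by (intro causalD(4) causal_shift d k square_integrable_diff square_integrable_cmult; simp)+
    have "(\<integral>t. (cmod (f (t - ?s) - f t))\<^sup>2 \<partial>lborel)
        = (\<integral>t. (cmod (d (t - ?s) + ((k (t - ?s) - k t) + (- 1) * d t)))\<^sup>2 \<partial>lborel)"
      by (simp add: d_def algebra_simps)
    also have "\<dots> \<le> 2 * (\<integral>t. (cmod (d (t - ?s)))\<^sup>2 \<partial>lborel)
        + 2 * (\<integral>t. (cmod ((k (t - ?s) - k t) + (- 1) * d t))\<^sup>2 \<partial>lborel)"
      by (intro integral_sq_add_le square_integrable_add ds)
    also have "(\<integral>t. (cmod (d (t - ?s)))\<^sup>2 \<partial>lborel) = (\<integral>t. (cmod (d t))\<^sup>2 \<partial>lborel)"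
      by (rule causal_shift(2)[OF d]) simp
    also have "(\<integral>t. (cmod ((k (t - ?s) - k t) + (- 1) * d t))\<^sup>2 \<partial>lborel)
        \<le> 2 * (\<integral>t. (cmod (k (t - ?s) - k t))\<^sup>2 \<partial>lborel) + 2 * (\<integral>t. (cmod ((- 1) * d t))\<^sup>2 \<partial>lborel)"
      by (intro integral_sq_add_le ds)
    also have "(\<integral>t. (cmod ((- 1) * d t))\<^sup>2 \<partial>lborel) = (\<integral>t. (cmod (d t))\<^sup>2 \<partial>lborel)" by simp
    finally show ?thesis using d_small N[OF that] e by simp
  qed
  then show "\<exists>no. \<forall>n\<ge>no. norm ((\<integral>t. (cmod (f (t - 1 / real (Suc n)) - f t))\<^sup>2 \<partial>lborel) - 0) < e"
    by (intro exI[of _ N]) simp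
qed

section \<open>Functions with exponentially decaying transform\<close>

text \<open>
  The damped function \<open>exp (- t / (n + 1)) * g t\<close> is integrable, and its transform at \<open>x\<close> is
  that of \<open>g\<close> at \<open>x + 1 / (n + 1)\<close>. In general such a translate is not dominated by the transform itself
  (\<open>\<mu>\<close> may be concentrated near its zeros), but here \<open>C * exp (- b * x)\<close> is a common majorant.
\<close>

lemma approximable_exp_decay:
  assumes \<mu>: "\<mu> \<in> class_M" and g: "causal g" and a: "a > 0" "\<And>t. t \<le> a \<Longrightarrow> g t = 0"
    and b: "b > 0" and decay: "\<And>x. x > 0 \<Longrightarrow> cmod (laplace g x) \<le> C * exp (- b * x)"
  shows "approximable \<mu> g"
proof -
  note [measurable] = causalD(1)[OF g]
  define s where "s n t = complex_of_real (exp (- t * (1 / real (Suc n)))) * g t" for n t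
  have s_m: "s n \<in> borel_measurable borel" for n unfolding s_def by measurable
  have s_le: "cmod (s n t) \<le> cmod (g t)" for n t
    using a(2)[of t] a(1) by (cases "t \<le> a") (auto simp: s_def norm_mult mult_left_le_one_le)
  have s_lim: "(\<lambda>n. s n t) \<longlonglongrightarrow> g t" for t
  proof -
    have "(\<lambda>n. complex_of_real (exp (- t * (1 / real (Suc n)))) * g t) \<longlonglongrightarrow> complex_of_real (exp (- t * 0)) * g t"
      by (intro tendsto_intros LIMSEQ_Suc[OF lim_1_over_n])
    then show ?thesis by (simp add: s_def)
  qed
  have G: "integrable lebesgue_pos (\<lambda>t. (cmod (g t))\<^sup>2)" using causalD(3)[OF g] by (simp add: square_integrable_def)
  have L2: "square_integrable lebesgue_pos (s n)" "(\<lambda>n. \<integral>t. (cmod (s n t - g t))\<^sup>2 \<partial>lebesgue_pos) \<longlonglongrightarrow> 0" for n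
    by (rule square_integrable_dominated[OF borel_measurable_lebesgue_pos[OF causalD(1)[OF g]]
        borel_measurable_lebesgue_pos[OF s_m] _ _ G]; use s_lim s_le in simp)+
  have app: "approximable \<mu> (s n)" for n
  proof (rule approximable_tame[OF \<mu> s_m])
    show "integrable lebesgue_pos (\<lambda>t. (cmod (s n t))\<^sup>2)" using L2(1) by (simp add: square_integrable_def)
    show "integrable lebesgue_pos (s n)"
      unfolding s_def[abs_def] by (rule laplace_integrable[OF causalD(3)[OF g]]) simp
    show "s n t = 0" if "t \<le> a" for t using a(2)[OF that] by (simp add: s_def)
  qed (fact a(1))
  have C: "C \<ge> 0"
  proof -
    have "0 \<le> C * exp (- b * 1)" using order_trans[OF norm_ge_zero decay[of 1]] by simp
    then show ?thesis by (simp add: zero_le_mult_iff)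
  qed
  have bound: "cmod (laplace (s n) x) \<le> C * exp (- b * x)" if "x > 0" for n x
  proof -
    have "exp (- t * (x + 1 / real (Suc n))) = exp (- t * x) * exp (- t * (1 / real (Suc n)))" for t
      unfolding exp_add[symmetric] by (simp only: distrib_left)
    then have "laplace (s n) x = laplace g (x + 1 / real (Suc n))"
      unfolding laplace_def s_def by (simp only: of_real_mult mult.assoc)
    also have "cmod \<dots> \<le> C * exp (- b * (x + 1 / real (Suc n)))"
      using that by (intro decay add_pos_pos) auto
    also have "\<dots> \<le> C * exp (- b * x)"
      using b C by (intro mult_left_mono) (auto simp: distrib_left)
    finally show ?thesis .
  qed
  have "set_integrable \<mu> {0<..} (\<lambda>x. exp (- (2 * b) * x) * C\<^sup>2)"
    using class_M_exp[OF \<mu>, of "2 * b"] b by (intro set_integrable_mult_left) auto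
  moreover have "(C * exp (- b * x))\<^sup>2 = exp (- (2 * b) * x) * C\<^sup>2" for x
    by (simp add: power_mult_distrib mult.assoc flip: exp_double)
  ultimately have "set_integrable \<mu> {0<..} (\<lambda>x. (C * exp (- b * x))\<^sup>2)" by simp
  note E = energy_tendsto_dominated[OF \<mu> L2(1) causalD(3)[OF g] L2(2) bound this]
  show ?thesis by (rule approximable_limit[OF \<mu> app E(1,3)])
qed

section \<open>Removing the behaviour of the transform at zero\<close>

text \<open>
  The mean of \<open>N\<close> delayed copies of \<open>h\<close>. Its transform is close to that of \<open>h\<close> near \<open>x = 0\<close>, while
  the function itself is small in $L^2$ because the copies hardly overlap.
\<close>

definition shift_average :: "nat \<Rightarrow> real \<Rightarrow> (real \<Rightarrow> complex) \<Rightarrow> real \<Rightarrow> complex" where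
  "shift_average N T h t = (\<Sum>k<N. h (t - real (Suc k) * T)) / of_nat N"

lemma cmod_sum_sq_single:
  fixes u :: "nat \<Rightarrow> complex"
  assumes "\<And>k l. k < N \<Longrightarrow> l < N \<Longrightarrow> u k \<noteq> 0 \<Longrightarrow> u l \<noteq> 0 \<Longrightarrow> k = l"
  shows "(cmod (\<Sum>k<N. u k))\<^sup>2 = (\<Sum>k<N. (cmod (u k))\<^sup>2)"
proof (cases "\<exists>k<N. u k \<noteq> 0")
  case True
  then obtain k where k: "k < N" "u k \<noteq> 0" by blast
  then have zero: "u l = 0" if "l \<in> {..<N} - {k}" for l using assms[OF k(1), of l] that by auto
  have "(\<Sum>l<N. u l) = u k" "(\<Sum>l<N. (cmod (u l))\<^sup>2) = (cmod (u k))\<^sup>2"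
    using k(1) zero by (simp_all add: sum.remove[of "{..<N}" k])
  then show ?thesis by simp
next
  case False
  then show ?thesis by simp
qed

lemma cmod_sum_sq_le:
  fixes u :: "nat \<Rightarrow> complex"
  shows "(cmod (\<Sum>k<N. u k))\<^sup>2 \<le> real N * (\<Sum>k<N. (cmod (u k))\<^sup>2)"
proof -
  have "(cmod (\<Sum>k<N. u k))\<^sup>2 \<le> (\<Sum>k<N. cmod (u k))\<^sup>2" by (intro power_mono norm_sum) auto
  also have "\<dots> \<le> (\<Sum>k<N. (cmod (u k))\<^sup>2) * card {..<N}" by (rule sum_squared_le_sum_of_squares)
  finally show ?thesis by (simp add: mult.commute)
qed

lemma causal_cut:
  assumes "causal h" "A \<in> sets borel"
  shows "causal (\<lambda>t. indicator A t * h t)"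
proof (rule causalI)
  note [measurable] = causalD(1)[OF assms(1)] assms(2)
  show "square_integrable lborel (\<lambda>t. indicator A t * h t)"
    by (rule square_integrable_bound[where h = "\<lambda>t. (cmod (h t))\<^sup>2"])
       (use causalD(4)[OF assms(1)] in \<open>auto simp: square_integrable_def indicator_def\<close>)
qed (use causalD(2)[OF assms(1)] in simp)

lemma causal_add: "causal f \<Longrightarrow> causal g \<Longrightarrow> causal (\<lambda>t. f t + g t)"
  by (rule causalI) (auto intro: square_integrable_add causalD simp: causalD(2))

lemma causal_cmult: "causal f \<Longrightarrow> causal (\<lambda>t. c * f t)"
  by (rule causalI) (auto intro: square_integrable_cmult causalD simp: causalD(2))

lemma causal_sum: "finite I \<Longrightarrow> (\<And>i. i \<in> I \<Longrightarrow> causal (f i)) \<Longrightarrow> causal (\<lambda>t. \<Sum>i\<in>I. f i t)"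
proof (induction I rule: finite_induct)
  case empty
  show ?case by (simp add: causal_def)
next
  case (insert i I)
  then show ?case using causal_add[of "f i" "\<lambda>t. \<Sum>i\<in>I. f i t"] by simp
qed

lemma causal_shift_average:
  assumes h: "causal h" and T: "T > 0"
  shows "causal (shift_average N T h)"
proof -
  have "causal (\<lambda>t. (1 / of_nat N) * (\<Sum>k<N. h (t - real (Suc k) * T)))"
    using T by (intro causal_cmult causal_sum causal_shift(1)[OF h]) auto
  then show ?thesis by (simp add: shift_average_def[abs_def])
qed

text \<open>
  The part of \<open>h\<close> on \<open>{0<..T}\<close> has copies with disjoint supports, so averaging gains the factor
  \<open>1 / N\<close>; the part on \<open>{T<..}\<close> is estimated by convexity.
\<close>

lemma shift_average_L2_bound:
  assumes h: "causal h" and T: "T > 0" and N: "N > 0"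
  shows "(\<integral>t. (cmod (shift_average N T h t))\<^sup>2 \<partial>lborel)
    \<le> 2 / real N * (\<integral>t. (cmod (h t))\<^sup>2 \<partial>lborel) + 2 * (\<integral>t. (cmod (indicator {T<..} t * h t))\<^sup>2 \<partial>lborel)"
proof -
  define u v where "u t = indicator {0<..T} t * h t" and "v t = indicator {T<..} t * h t" for t
  have u: "causal u" and v: "causal v"
    unfolding u_def[abs_def] v_def[abs_def] by (intro causal_cut h; simp)+
  have split: "h t = u t + v t" for t
    using causalD(2)[OF h, of t] T by (auto simp: u_def v_def indicator_def)
  define c where "c k = real (Suc k) * T" for k
  have c: "c k \<ge> 0" for k using T by (simp add: c_def)
  have pointwise: "(cmod (shift_average N T h t))\<^sup>2
      \<le> 2 / (real N)\<^sup>2 * (\<Sum>k<N. (cmod (u (t - c k)))\<^sup>2) + 2 / real N * (\<Sum>k<N. (cmod (v (t - c k)))\<^sup>2)" for t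
  proof -
    have "(cmod (\<Sum>k<N. u (t - c k)))\<^sup>2 = (\<Sum>k<N. (cmod (u (t - c k)))\<^sup>2)"
    proof (rule cmod_sum_sq_single)
      fix k l assume "u (t - c k) \<noteq> 0" "u (t - c l) \<noteq> 0"
      then have "0 < t - c k" "t - c k \<le> T" "0 < t - c l" "t - c l \<le> T"
        by (auto simp: u_def indicator_def split: if_splits)
      then have "real (Suc k) * T < real (Suc (Suc l)) * T" "real (Suc l) * T < real (Suc (Suc k)) * T"
        by (auto simp: c_def distrib_right)
      then have "Suc k < Suc (Suc l)" "Suc l < Suc (Suc k)"
        using T by (simp_all only: mult_less_cancel_right_pos of_nat_less_iff)
      then show "k = l" by simp
    qed
    moreover have "(cmod (\<Sum>k<N. v (t - c k)))\<^sup>2 \<le> real N * (\<Sum>k<N. (cmod (v (t - c k)))\<^sup>2)"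
      by (rule cmod_sum_sq_le)
    moreover have "shift_average N T h t = ((\<Sum>k<N. u (t - c k)) + (\<Sum>k<N. v (t - c k))) / of_nat N"
      by (simp add: shift_average_def split sum.distrib c_def)
    then have "(cmod (shift_average N T h t))\<^sup>2 = (cmod ((\<Sum>k<N. u (t - c k)) + (\<Sum>k<N. v (t - c k))))\<^sup>2 / (real N)\<^sup>2"
      by (simp add: norm_divide power_divide)
    moreover have "\<dots> \<le> (2 * (cmod (\<Sum>k<N. u (t - c k)))\<^sup>2 + 2 * (cmod (\<Sum>k<N. v (t - c k)))\<^sup>2) / (real N)\<^sup>2"
      by (intro divide_right_mono cmod_add_sq_le) simp
    ultimately have "(cmod (shift_average N T h t))\<^sup>2
      \<le> (2 * (\<Sum>k<N. (cmod (u (t - c k)))\<^sup>2) + 2 * (real N * (\<Sum>k<N. (cmod (v (t - c k)))\<^sup>2))) / (real N)\<^sup>2"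
      by (smt (verit) divide_right_mono zero_le_power2)
    also have "\<dots> = 2 / (real N)\<^sup>2 * (\<Sum>k<N. (cmod (u (t - c k)))\<^sup>2) + 2 / real N * (\<Sum>k<N. (cmod (v (t - c k)))\<^sup>2)"
      using N by (simp add: add_divide_distrib power2_eq_square)
    finally show ?thesis .
  qed
  have int: "integrable lborel (\<lambda>t. (cmod (w (t - c k)))\<^sup>2)" if "causal w" for w k
    using causal_shift(1)[OF that c[of k]] by (simp add: causal_def)
  have "(\<integral>t. (cmod (shift_average N T h t))\<^sup>2 \<partial>lborel)
      \<le> (\<integral>t. 2 / (real N)\<^sup>2 * (\<Sum>k<N. (cmod (u (t - c k)))\<^sup>2) + 2 / real N * (\<Sum>k<N. (cmod (v (t - c k)))\<^sup>2) \<partial>lborel)"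
    using causal_shift_average[OF h T, of N]
    by (intro integral_mono pointwise Bochner_Integration.integrable_add integrable_mult_right
        Bochner_Integration.integrable_sum int u v) (simp add: causal_def)
  also have "\<dots> = 2 / (real N)\<^sup>2 * (\<Sum>k<N. \<integral>t. (cmod (u (t - c k)))\<^sup>2 \<partial>lborel)
      + 2 / real N * (\<Sum>k<N. \<integral>t. (cmod (v (t - c k)))\<^sup>2 \<partial>lborel)"
    by (simp add: int u v Bochner_Integration.integrable_sum Bochner_Integration.integral_sum)
  also have "\<dots> = 2 / real N * (\<integral>t. (cmod (u t))\<^sup>2 \<partial>lborel) + 2 * (\<integral>t. (cmod (v t))\<^sup>2 \<partial>lborel)"
  proof -
    have "2 / (real N)\<^sup>2 * (real N * z) = 2 / real N * z" "2 / real N * (real N * z) = 2 * z" for z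
      using N by (simp_all add: power2_eq_square)
    then show ?thesis by (simp only: causal_shift(2)[OF u c] causal_shift(2)[OF v c] sum_constant card_lessThan)
  qed
  finally have "(\<integral>t. (cmod (shift_average N T h t))\<^sup>2 \<partial>lborel)
      \<le> 2 / real N * (\<integral>t. (cmod (u t))\<^sup>2 \<partial>lborel) + 2 * (\<integral>t. (cmod (v t))\<^sup>2 \<partial>lborel)" .
  moreover have "(\<integral>t. (cmod (u t))\<^sup>2 \<partial>lborel) \<le> (\<integral>t. (cmod (h t))\<^sup>2 \<partial>lborel)"
    using u h by (intro integral_mono) (auto simp: causal_def u_def indicator_def)
  then have "2 / real N * (\<integral>t. (cmod (u t))\<^sup>2 \<partial>lborel) \<le> 2 / real N * (\<integral>t. (cmod (h t))\<^sup>2 \<partial>lborel)"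
    by (intro mult_left_mono) auto
  ultimately show ?thesis unfolding v_def by linarith
qed

lemma shift_average_tendsto_zero:
  assumes h: "causal h"
  shows "(\<lambda>n. \<integral>t. (cmod (shift_average (Suc n) (Suc n) h t))\<^sup>2 \<partial>lborel) \<longlonglongrightarrow> 0"
proof (rule tendsto_sandwich[OF _ _ tendsto_const])
  let ?A = "\<integral>t. (cmod (h t))\<^sup>2 \<partial>lborel"
  let ?r = "\<lambda>n. \<integral>t. (cmod (indicator {real (Suc n)<..} t * h t))\<^sup>2 \<partial>lborel"
  note [measurable] = causalD(1)[OF h]
  have "?r \<longlonglongrightarrow> (\<integral>t. 0 \<partial>(lborel :: real measure))"
  proof (rule integral_dominated_convergence[where w = "\<lambda>t. (cmod (h t))\<^sup>2"])
    show "AE t in lborel. (\<lambda>n. (cmod (indicator {real (Suc n)<..} t * h t))\<^sup>2) \<longlonglongrightarrow> 0"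
    proof (rule AE_I2)
      fix t
      obtain M :: nat where M: "t < real M" using reals_Archimedean2 by blast
      have "\<forall>\<^sub>F n in sequentially. 0 = (cmod (indicator {real (Suc n)<..} t * h t))\<^sup>2"
        using eventually_ge_at_top[of M] by eventually_elim (use M in auto)
      then show "(\<lambda>n. (cmod (indicator {real (Suc n)<..} t * h t))\<^sup>2) \<longlonglongrightarrow> 0"
        by (rule Lim_transform_eventually[OF tendsto_const])
    qed
    show "integrable lborel (\<lambda>t. (cmod (h t))\<^sup>2)" using h by (simp add: causal_def)
  qed (auto simp: indicator_def)
  then have r: "?r \<longlonglongrightarrow> 0" by simp
  have "(\<lambda>n. 2 * ?A * (1 / real (Suc n)) + 2 * ?r n) \<longlonglongrightarrow> 2 * ?A * 0 + 2 * 0"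
    by (intro tendsto_intros r LIMSEQ_Suc[OF lim_1_over_n])
  then show "(\<lambda>n. 2 / real (Suc n) * ?A + 2 * ?r n) \<longlonglongrightarrow> 0" by (simp add: mult.commute)
  show "\<forall>\<^sub>F n in sequentially. (\<integral>t. (cmod (shift_average (Suc n) (Suc n) h t))\<^sup>2 \<partial>lborel)
      \<le> 2 / real (Suc n) * ?A + 2 * ?r n"
    by (intro always_eventually allI shift_average_L2_bound h) auto
qed simp

lemma laplace_shift_average:
  assumes h: "causal h" and T: "T > 0" and x: "x > 0"
  shows "laplace (shift_average N T h) x
    = complex_of_real ((\<Sum>k<N. exp (- (real (Suc k) * T) * x)) / real N) * laplace h x"
proof -
  have c: "causal (\<lambda>t. h (t - real (Suc k) * T))" for k using T by (intro causal_shift(1)[OF h]) simp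
  have "laplace (\<lambda>t. \<Sum>k<n. h (t - real (Suc k) * T)) x
      = (\<Sum>k<n. complex_of_real (exp (- (real (Suc k) * T) * x)) * laplace h x)" for n
  proof (induction n)
    case 0
    show ?case by (simp add: laplace_def)
  next
    case (Suc n)
    have "laplace (\<lambda>t. (\<Sum>k<n. h (t - real (Suc k) * T)) + h (t - real (Suc n) * T)) x
        = laplace (\<lambda>t. \<Sum>k<n. h (t - real (Suc k) * T)) x + laplace (\<lambda>t. h (t - real (Suc n) * T)) x"
      by (intro laplace_add x causalD(3) causal_sum c) simp
    also have "laplace (\<lambda>t. h (t - real (Suc n) * T)) x
        = complex_of_real (exp (- (real (Suc n) * T) * x)) * laplace h x"
      using T by (intro causal_shift(3)[OF h]) simp
    finally show ?case using Suc by simp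
  qed
  then have "laplace (\<lambda>t. (1 / of_nat N) * (\<Sum>k<N. h (t - real (Suc k) * T))) x
      = (1 / of_nat N) * (\<Sum>k<N. complex_of_real (exp (- (real (Suc k) * T) * x)) * laplace h x)"
    by (simp only: laplace_cmult)
  then show ?thesis by (simp add: shift_average_def[abs_def] sum_distrib_right sum_divide_distrib)
qed

text \<open>
  Subtracting the average multiplies the transform by \<open>1 - m\<close>. This factor lies in \<open>{0..1}\<close>, so the
  original transform remains a majorant, and it vanishes to first order at zero.
\<close>

lemma average_multiplier:
  assumes T: "T > 0" and x: "x > 0" and N: "N > 0"
  defines "m \<equiv> (\<Sum>k<N. exp (- (real (Suc k) * T) * x)) / real N"
  shows "0 \<le> m" "m \<le> 1" "1 - m \<le> real N * T * x"
proof -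
  show "0 \<le> m" by (simp add: m_def sum_nonneg)
  have "(\<Sum>k<N. exp (- (real (Suc k) * T) * x)) \<le> (\<Sum>k<N. 1)"
    using T x by (intro sum_mono) simp
  then show "m \<le> 1" using N by (simp add: m_def)
  have "(\<Sum>k<N. 1 - real N * T * x) \<le> (\<Sum>k<N. exp (- (real (Suc k) * T) * x))"
  proof (rule sum_mono)
    fix k assume "k \<in> {..<N}"
    then have "real (Suc k) * (T * x) \<le> real N * (T * x)"
      using T x by (intro mult_right_mono) auto
    then show "1 - real N * T * x \<le> exp (- (real (Suc k) * T) * x)"
      using exp_ge_add_one_self[of "- (real (Suc k) * T) * x"] by (simp add: mult.assoc)
  qed
  then have "1 - real N * T * x \<le> m"
    using N by (simp add: m_def pos_le_divide_eq mult.commute)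
  then show "1 - m \<le> real N * T * x" by simp
qed

text \<open>
  The delay \<open>a\<close> gives decay at infinity, and subtracting averages of \<open>h\<close> turns the singularity
  \<open>x powr (- 1 / 2)\<close> of the transform at zero into a zero. The result has an exponentially decaying
  transform, hence is approximable. As the number of copies and their spacing grow, the
  subtracted averages tend to zero in $L^2$, and all transforms are dominated by that of \<open>f\<close>.
\<close>

lemma approximable_delayed:
  assumes \<mu>: "\<mu> \<in> class_M" and f: "causal f" "f \<in> Dom_Q \<mu>" and a: "a > 0"
  shows "approximable \<mu> (\<lambda>t. f (t - a))"
proof -
  define h where "h t = f (t - a)" for t
  have h: "causal h" unfolding h_def[abs_def] using a by (intro causal_shift f) simp
  have hz: "h t = 0" if "t \<le> a" for t using causalD(2)[OF f(1)] that by (simp add: h_def)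
  have Lh: "laplace h x = complex_of_real (exp (- a * x)) * laplace f x" for x
    unfolding h_def[abs_def] using a by (intro causal_shift(3) f) simp
  define g where "g n t = h t + (- 1) * shift_average (Suc n) (Suc n) h t" for n t
  have g: "causal (g n)" for n
    unfolding g_def[abs_def] by (intro causal_add causal_cmult h causal_shift_average) simp
  define m where "m n x = (\<Sum>k<Suc n. exp (- (real (Suc k) * real (Suc n)) * x)) / real (Suc n)" for n x
  have m: "0 \<le> m n x" "m n x \<le> 1" "1 - m n x \<le> real (Suc n) * real (Suc n) * x" if "x > 0" for n x
    using average_multiplier[of "real (Suc n)" x "Suc n"] that unfolding m_def by simp_all
  have Lg: "laplace (g n) x = complex_of_real ((1 - m n x) * exp (- a * x)) * laplace f x" if "x > 0" for n x
  proof -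
    have "laplace (g n) x = laplace h x + (- 1) * laplace (shift_average (Suc n) (Suc n) h) x"
      unfolding g_def[abs_def] laplace_cmult[symmetric]
      by (intro laplace_add that causalD(3) causal_cmult h causal_shift_average) simp
    also have "laplace (shift_average (Suc n) (Suc n) h) x = complex_of_real (m n x) * laplace h x"
      unfolding m_def by (rule laplace_shift_average[OF h _ that]) simp
    finally show ?thesis by (simp add: Lh algebra_simps)
  qed
  have Lg_norm: "cmod (laplace (g n) x) = (1 - m n x) * exp (- a * x) * cmod (laplace f x)" if "x > 0" for n x
    using m[OF that, of n] by (simp only: Lg[OF that] norm_mult norm_of_real) simp
  define A where "A = (\<integral>t. (cmod (f t))\<^sup>2 \<partial>lebesgue_pos)"
  have A: "A \<ge> 0" by (simp add: A_def)
  have app: "approximable \<mu> (g n)" for n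
  proof (rule approximable_exp_decay[OF \<mu> g a])
    show "g n t = 0" if "t \<le> a" for t
    proof -
      have "0 \<le> real (Suc k) * real (Suc n)" for k by simp
      then have "h (t - real (Suc k) * real (Suc n)) = 0" for k
        using that by (intro hz) (meson diff_le_eq le_add_same_cancel1 order_trans)
      then show ?thesis using hz[OF that] by (simp add: g_def shift_average_def del: of_nat_Suc)
    qed
    show "a / 2 > 0" using a by simp
    fix x :: real assume x: "x > 0"
    have e: "exp (- a * x) = exp (- (a / 2) * x) * exp (- (a / 2) * x)"
      by (simp flip: exp_add)
    \<comment> \<open>Half of the decay from the delay absorbs the growth of \<open>x * cmod (laplace f x)\<close> at infinity.\<close>
    have xe: "x * exp (- (a / 2) * x) \<le> 2 / a"
    proof -
      have "a / 2 * x \<le> exp (a / 2 * x)" using exp_ge_add_one_self[of "a / 2 * x"] by linarith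
      then show ?thesis using a by (simp add: exp_minus field_simps)
    qed
    have "x * cmod (laplace f x) \<le> A + x"
    proof -
      have "x * (2 * cmod (laplace f x)) \<le> x * ((cmod (laplace f x))\<^sup>2 + 1)"
        using sum_squares_bound[of "cmod (laplace f x)" 1] x by (intro mult_left_mono) auto
      also have "\<dots> \<le> x * (A / (2 * x) + 1)"
        using laplace_bound[OF causalD(3)[OF f(1)] x] x by (intro mult_left_mono add_right_mono) (auto simp: A_def)
      also have "\<dots> = A / 2 + x" using x by (simp add: field_simps)
      finally show ?thesis using A x by simp
    qed
    then have "x * cmod (laplace f x) * exp (- (a / 2) * x) \<le> (A + x) * exp (- (a / 2) * x)"
      by (intro mult_right_mono) auto
    also have "\<dots> \<le> A + 2 / a"
      using xe A x a mult_left_mono[of "exp (- (a / 2) * x)" 1 A] by (simp add: distrib_right)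
    finally have xF: "x * cmod (laplace f x) * exp (- (a / 2) * x) \<le> A + 2 / a" .
    have "cmod (laplace (g n) x) \<le> (real (Suc n) * real (Suc n) * x) * exp (- a * x) * cmod (laplace f x)"
      unfolding Lg_norm[OF x] by (intro mult_right_mono m(3) x) auto
    also have "\<dots> = real (Suc n) * real (Suc n) * (x * cmod (laplace f x) * exp (- (a / 2) * x)) * exp (- (a / 2) * x)"
      unfolding e by (simp only: ac_simps)
    also have "\<dots> \<le> real (Suc n) * real (Suc n) * (A + 2 / a) * exp (- (a / 2) * x)"
      by (intro mult_right_mono mult_left_mono xF) auto
    finally show "cmod (laplace (g n) x) \<le> (real (Suc n) * real (Suc n) * (A + 2 / a)) * exp (- (a / 2) * x)" .
  qed
  have lim: "(\<lambda>n. \<integral>t. (cmod (g n t - h t))\<^sup>2 \<partial>lebesgue_pos) \<longlonglongrightarrow> 0"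
  proof -
    have "(\<integral>t. (cmod (g n t - h t))\<^sup>2 \<partial>lebesgue_pos) = (\<integral>t. (cmod (shift_average (Suc n) (Suc n) h t))\<^sup>2 \<partial>lborel)" for n
      using causalD(5)[OF causal_shift_average[OF h], of "real (Suc n)" "Suc n"] by (simp add: g_def)
    then show ?thesis using shift_average_tendsto_zero[OF h] by simp
  qed
  have bound: "cmod (laplace (g n) x) \<le> cmod (laplace f x)" if "x > 0" for n x
    unfolding Lg_norm[OF that] using m[OF that, of n] that a
    by (intro mult_left_le_one_le mult_le_one) auto
  have G: "set_integrable \<mu> {0<..} (\<lambda>x. (cmod (laplace f x))\<^sup>2)" using f(2) by (simp add: Dom_Q_def)
  note E = energy_tendsto_dominated[OF \<mu> causalD(3)[OF g] causalD(3)[OF h] lim bound G]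
  have "approximable \<mu> h" by (rule approximable_limit[where s = g, OF \<mu> app E(1,3)])
  then show ?thesis by (simp add: h_def[abs_def])
qed

text \<open>
  Delayed copies converge to \<open>f\<close> in $L^2$ by continuity of translations, and their transforms are
  dominated by that of \<open>f\<close>.
\<close>

lemma approximable_causal:
  assumes \<mu>: "\<mu> \<in> class_M" and f: "causal f" "f \<in> Dom_Q \<mu>"
  shows "approximable \<mu> f"
proof -
  define s where "s n t = f (t - 1 / real (Suc n))" for n t
  have s: "causal (s n)" for n unfolding s_def[abs_def] by (intro causal_shift f) simp
  have app: "approximable \<mu> (s n)" for n unfolding s_def[abs_def] by (intro approximable_delayed \<mu> f) simp
  have lim: "(\<lambda>n. \<integral>t. (cmod (s n t - f t))\<^sup>2 \<partial>lebesgue_pos) \<longlonglongrightarrow> 0"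
  proof -
    have "causal (\<lambda>t. s n t + (- 1) * f t)" for n by (intro causal_add causal_cmult s f)
    from causalD(5)[OF this]
    have "(\<integral>t. (cmod (s n t - f t))\<^sup>2 \<partial>lebesgue_pos) = (\<integral>t. (cmod (s n t - f t))\<^sup>2 \<partial>lborel)" for n by simp
    then show ?thesis using translation_continuous_L2[OF f(1)] by (simp add: s_def)
  qed
  have bound: "cmod (laplace (s n) x) \<le> cmod (laplace f x)" if "x > 0" for n x
  proof -
    have "laplace (s n) x = complex_of_real (exp (- (1 / real (Suc n)) * x)) * laplace f x"
      unfolding s_def[abs_def] by (intro causal_shift(3) f) simp
    then show ?thesis using that by (auto simp: norm_mult intro!: mult_left_le_one_le)
  qed
  have G: "set_integrable \<mu> {0<..} (\<lambda>x. (cmod (laplace f x))\<^sup>2)" using f(2) by (simp add: Dom_Q_def)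
  note E = energy_tendsto_dominated[OF \<mu> causalD(3)[OF s] causalD(3)[OF f(1)] lim bound G]
  show ?thesis by (rule approximable_limit[where s = s, OF \<mu> app f(2) E(3)])
qed

section \<open>Density of the test functions\<close>

lemma ex_causal_version:
  assumes f: "square_integrable lebesgue_pos f"
  obtains f' where "causal f'" "AE t in lebesgue_pos. f t = f' t"
proof -
  have m: "(\<lambda>t. indicator {0<..} t *\<^sub>R f t) \<in> borel_measurable lebesgue"
    using f by (simp add: borel_measurable_restrict_space_iff square_integrable_def)
  then have "(\<lambda>t. Re (indicator {0<..} t *\<^sub>R f t)) \<in> borel_measurable lebesgue"
    "(\<lambda>t. Im (indicator {0<..} t *\<^sub>R f t)) \<in> borel_measurable lebesgue" by measurable
  then obtain p q where [measurable]: "p \<in> borel_measurable lborel" "q \<in> borel_measurable lborel"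
    and ae: "AE t in lborel. Re (indicator {0<..} t *\<^sub>R f t) = p t" "AE t in lborel. Im (indicator {0<..} t *\<^sub>R f t) = q t"
    by (elim bexE[OF completion_ex_borel_measurable_real]) blast
  define f' where "f' t = indicator {0<..} t *\<^sub>R Complex (p t) (q t)" for t
  have "(\<lambda>t. complex_of_real (p t) + \<i> * complex_of_real (q t)) \<in> borel_measurable borel" by measurable
  then have f'_m: "f' \<in> borel_measurable borel" by (simp add: f'_def[abs_def] Complex_eq)
  have "AE t in lborel. t \<in> {0<..} \<longrightarrow> f t = f' t"
    using ae by eventually_elim (auto simp: f'_def complex_eq_iff)
  then have ae': "AE t in lebesgue_pos. f t = f' t"
    by (subst AE_restrict_space_iff) (auto intro: AE_completion)
  have "square_integrable lebesgue_pos f'"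
    by (rule square_integrable_cong_AE[OF f borel_measurable_lebesgue_pos[OF f'_m] ae'])
  moreover have "f' t = 0" if "t \<le> 0" for t using that by (simp add: f'_def)
  ultimately have "causal f'" using causal_square_integrable(1)[OF f'_m] by blast
  then show thesis using that ae' by blast
qed

lemma approximable_Dom_Q:
  assumes \<mu>: "\<mu> \<in> class_M" and f: "f \<in> Dom_Q \<mu>"
  shows "approximable \<mu> f"
proof -
  have L2: "square_integrable lebesgue_pos f" using f \<mu> by (simp add: Dom_Q_iff)
  obtain f' where f': "causal f'" "AE t in lebesgue_pos. f t = f' t" using ex_causal_version[OF L2] .
  note D = Dom_Q_cong_AE[OF \<mu> f f'(2)]
  have "(\<integral>t. (cmod (f' t - f t))\<^sup>2 \<partial>lebesgue_pos) = (\<integral>t. 0 \<partial>lebesgue_pos)"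
    using f'(2) square_integrable_diff[OF causalD(3)[OF f'(1)] L2]
    by (intro integral_cong_AE) (auto simp: square_integrable_def dest: borel_measurable_integrable)
  then have "energy \<mu> (\<lambda>t. f' t - f t) = 0"
    by (simp add: energy_def laplace_pos_diff[OF causalD(3)[OF f'(1)] L2] D(2))
  then show ?thesis
    by (intro approximable_limit[OF \<mu> approximable_causal[OF \<mu> f'(1) D(1)] f]) simp
qed

theorem theorem2p1:
  fixes \<mu> :: "real measure"
  assumes "\<mu> \<in> class_M"
  shows "closed_form (Dom_Q \<mu>) (Q_form \<mu>) \<and>
         dense_wrt (form_norm (Q_form \<mu>)) Cinf_comp (Dom_Q \<mu>)"
proof
  show "closed_form (Dom_Q \<mu>) (Q_form \<mu>)" by (rule closed_form_Q_form[OF assms])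
  have "\<exists>h\<in>Cinf_comp. form_norm (Q_form \<mu>) (\<lambda>t. f t - h t) < e" if f: "f \<in> Dom_Q \<mu>" and e: "e > 0" for f e
  proof -
    have "e\<^sup>2 > 0" using e by simp
    then obtain h where h: "h \<in> Cinf_comp" "energy \<mu> (\<lambda>t. f t - h t) < e\<^sup>2"
      using approximable_Dom_Q[OF assms f] unfolding approximable_def by blast
    have "sqrt (energy \<mu> (\<lambda>t. f t - h t)) < e"
      using real_sqrt_less_mono[OF h(2)] e by simp
    then show ?thesis using h(1) by (auto simp: form_norm_eq)
  qed
  then show "dense_wrt (form_norm (Q_form \<mu>)) Cinf_comp (Dom_Q \<mu>)"
    using Cinf_comp_subset_Dom_Q[OF assms] by (simp add: dense_wrt_def)
qed

end
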